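(* Let $\Omega\subset\mathbb{R}^d$ be open and bounded, $\Gamma\subset\mathbb{R}^s$ compact, and $U:=\Omega\times\Gamma$. Let $f:U\times\mathbb{R}^m\to[0,\infty]$ be lower semicontinuous (jointly) in both variables, convex in the second variable, and such that $t\mapsto f(t,0)$ is locally bounded on $U$. Let $u:\Omega\to\Gamma$ and $p:\Omega\to\mathbb{R}^m$ be measurable with $$\tilde F(u,p):=\int_\Omega f(x,u(x),p(x))\,\mathrm{d}x<\infty .$$ Let $(E,\mu)\in\mathcal{M}(U,\mathbb{R}^m\times\mathbb{R})$ be such that $\mu=\delta_u$ and $E=p\,\delta_u$, the latter meaning $$\int_U\langle\phi,\mathrm{d}E\rangle=\int_\Omega\langle\phi(x,u(x)),p(x)\rangle\,\mathrm{d}x\qquad\forall\phi\in C_0(U,\mathbb{R}^m).$$ Then $$\mathfrak{B}_f((E,\mu))=\int_\Omega f(x,u(x),p(x))\,\mathrm{d}x=\tilde F(u,p).$$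
   Context: $C_0(U,\mathbb{R}^k)$ is the closure, in the supremum norm, of the compactly supported continuous functions $U\to\mathbb{R}^k$; $\mathcal{M}(U,\mathbb{R}^k)$ is the space of (finite) $\mathbb{R}^k$-valued Radon measures on $U$. We write $f(t,p)=f(x,z,p)$ for $t=(x,z)\in U$. The graph-concentrated measure $\delta_u$ is defined by $\int_U\phi\,\mathrm{d}\delta_u:=\int_\Omega\phi(x,u(x))\,\mathrm{d}x$ for all $\phi\in C_0(U,\mathbb{R})$. The convex conjugate is taken in the last variable: $f^*(t,\xi):=\sup_{p\in\mathbb{R}^m}\langle\xi,p\rangle-f(t,p)$. The generalized Benamou-Brenier functional is, for $\nu=(E,\mu)\in\mathcal{M}(U,\mathbb{R}^m\times\mathbb{R})$, $$\mathfrak{B}_f(\nu):=\sup_{(\phi^\xi,\phi^\lambda)\in\mathcal{K}_f}\int_U\langle\phi^\xi,\mathrm{d}E\rangle+\int_U\phi^\lambda\,\mathrm{d}\mu,$$ $$\mathcal{K}_f:=\{(\phi^{\xi},\phi^{\lambda})\in C_0(U,\mathbb{R}^m\times\mathbb{R}) : f^*(t,\phi^{\xi}(t))+\phi^{\lambda}(t)\le 0\ \ \forall t\in U\}.$$ *)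

theory Defs
  imports "HOL-Analysis.Analysis"
begin

section \<open>Continuous functions vanishing at infinity\<close>

text \<open>
  Functions on \<open>U\<close> are total functions of which only the values on \<open>U\<close> matter.
  The support is taken relative to \<open>U\<close>.
\<close>

definition Cc_on :: "'a::topological_space set \<Rightarrow> ('a \<Rightarrow> 'b::real_normed_vector) set" where
  "Cc_on U = {\<psi>. continuous_on U \<psi> \<and> compact (U \<inter> closure (support_on U \<psi>))}"

definition C0_on :: "'a::topological_space set \<Rightarrow> ('a \<Rightarrow> 'b::real_normed_vector) set" where
  "C0_on U = {\<phi>. \<forall>\<epsilon>>0. \<exists>\<psi>\<in>Cc_on U. \<forall>t\<in>U. norm (\<phi> t - \<psi> t) \<le> \<epsilon>}"


section \<open>Finite vector-valued Radon measures\<close>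

text \<open>
  A finite vector-valued Radon measure on \<open>U\<close> is a \<open>\<sigma>\<close>-additive function on the Borel sets
  of \<open>U\<close> whose total variation is inner regular with respect to compact sets: the total
  variation of \<open>A - K\<close> is small iff all values on Borel subsets of \<open>A - K\<close> are
  uniformly small.  Finiteness of the total variation is a consequence of \<open>\<sigma>\<close>-additivity.
\<close>

definition radon_vector_measure ::
    "'a::topological_space set \<Rightarrow> ('a set \<Rightarrow> 'b::real_normed_vector) \<Rightarrow> bool" where
  "radon_vector_measure U \<nu> \<longleftrightarrow>
     \<nu> {} = 0 \<and>
     (\<forall>A :: nat \<Rightarrow> 'a set. range A \<subseteq> sets (restrict_space borel U) \<longrightarrow> disjoint_family A \<longrightarrow>
        (\<lambda>i. \<nu> (A i)) sums \<nu> (\<Union>i. A i)) \<and>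
     (\<forall>A\<in>sets (restrict_space borel U). \<forall>\<epsilon>>0. \<exists>K\<subseteq>A. compact K \<and>
        (\<forall>B\<in>sets (restrict_space borel U). B \<subseteq> A - K \<longrightarrow> norm (\<nu> B) \<le> \<epsilon>))"

text \<open>
  The positive part of the Jordan decomposition of a signed measure; since \<open>ennreal\<close> maps
  negative reals to \<open>0\<close>, the value on \<open>A\<close> is the supremum of the values on measurable subsets.
\<close>

definition pos_variation :: "'a measure \<Rightarrow> ('a set \<Rightarrow> real) \<Rightarrow> 'a measure" where
  "pos_variation M \<nu> = measure_of (space M) (sets M)
     (\<lambda>A. SUP B\<in>{B \<in> sets M. B \<subseteq> A}. ennreal (\<nu> B))"

definition signed_integral :: "'a measure \<Rightarrow> ('a set \<Rightarrow> real) \<Rightarrow> ('a \<Rightarrow> real) \<Rightarrow> real" where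
  "signed_integral M \<nu> \<phi> =
     integral\<^sup>L (pos_variation M \<nu>) \<phi> - integral\<^sup>L (pos_variation M (\<lambda>A. - \<nu> A)) \<phi>"

lemma signed_integral_measure:
  assumes "finite_measure M"
  shows "signed_integral M (measure M) \<phi> = integral\<^sup>L M \<phi>"
proof -
  interpret finite_measure M by fact
  have "(SUP B\<in>{B \<in> sets M. B \<subseteq> A}. ennreal (measure M B)) = emeasure M A" if "A \<in> sets M" for A
    using that by (intro antisym SUP_least SUP_upper2[of A])
      (auto simp: emeasure_eq_measure[symmetric] intro: emeasure_mono)
  then have "pos_variation M (measure M) = measure_of (space M) (sets M) (emeasure M)"
    unfolding pos_variation_def
    by (intro measure_of_eq sets.space_closed) (simp add: sets.sigma_sets_eq)
  then have 1: "pos_variation M (measure M) = M"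
    by (simp add: measure_of_of_measure)
  have "(\<lambda>A. SUP B\<in>{B \<in> sets M. B \<subseteq> A}. ennreal (- measure M B)) = (\<lambda>A. 0)"
    by (auto simp: fun_eq_iff ennreal_neg intro!: antisym SUP_least)
  then have "pos_variation M (\<lambda>A. - measure M A) = null_measure M"
    by (simp add: pos_variation_def null_measure_def)
  then show ?thesis
    by (simp add: signed_integral_def 1 integral_null_measure)
qed

definition vector_integral ::
    "'a::topological_space set \<Rightarrow> ('a set \<Rightarrow> 'b::euclidean_space) \<Rightarrow> ('a \<Rightarrow> 'b) \<Rightarrow> real" where
  "vector_integral U \<nu> \<phi> =
     (\<Sum>b\<in>Basis. signed_integral (restrict_space borel U) (\<lambda>A. \<nu> A \<bullet> b) (\<lambda>t. \<phi> t \<bullet> b))"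


section \<open>Measures concentrated on a graph\<close>

definition is_graph_delta ::
    "'d::euclidean_space set \<Rightarrow> 's::euclidean_space set \<Rightarrow> ('d \<Rightarrow> 's)
      \<Rightarrow> (('d \<times> 's) set \<Rightarrow> real) \<Rightarrow> bool" where
  "is_graph_delta \<Omega> \<Gamma> u \<mu> \<longleftrightarrow>
     (\<forall>\<phi>\<in>C0_on (\<Omega> \<times> \<Gamma>).
        vector_integral (\<Omega> \<times> \<Gamma>) \<mu> \<phi> = (LINT x|lebesgue_on \<Omega>. \<phi> (x, u x)))"

text \<open>
  As \<open>p\<close> is only assumed measurable, the requirement that the integrals on the right-hand side
  exist has to be made explicit: the Bochner integral of a non-integrable function is \<open>0\<close>.
\<close>

definition is_graph_density ::
    "'d::euclidean_space set \<Rightarrow> 's::euclidean_space set \<Rightarrow> ('d \<Rightarrow> 's) \<Rightarrow> ('d \<Rightarrow> 'm::euclidean_space)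
      \<Rightarrow> (('d \<times> 's) set \<Rightarrow> 'm) \<Rightarrow> bool" where
  "is_graph_density \<Omega> \<Gamma> u p E \<longleftrightarrow>
     (\<forall>\<phi>\<in>C0_on (\<Omega> \<times> \<Gamma>).
        integrable (lebesgue_on \<Omega>) (\<lambda>x. \<phi> (x, u x) \<bullet> p x) \<and>
        vector_integral (\<Omega> \<times> \<Gamma>) E \<phi> = (LINT x|lebesgue_on \<Omega>. \<phi> (x, u x) \<bullet> p x))"


section \<open>Integrands and the generalized Benamou-Brenier functional\<close>

definition lsc_on :: "'a::topological_space set \<Rightarrow> ('a \<Rightarrow> 'b::linorder) \<Rightarrow> bool" where
  "lsc_on S g \<longleftrightarrow> (\<forall>x\<in>S. \<forall>y<g x. \<forall>\<^sub>F z in at x within S. y < g z)"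

definition ennreal_convex :: "('a::real_vector \<Rightarrow> ennreal) \<Rightarrow> bool" where
  "ennreal_convex g \<longleftrightarrow>
     (\<forall>p q a b. 0 \<le> a \<longrightarrow> 0 \<le> b \<longrightarrow> a + b = 1 \<longrightarrow>
        g (a *\<^sub>R p + b *\<^sub>R q) \<le> ennreal a * g p + ennreal b * g q)"

definition locally_bounded_on :: "'a::topological_space set \<Rightarrow> ('a \<Rightarrow> ennreal) \<Rightarrow> bool" where
  "locally_bounded_on U g \<longleftrightarrow>
     (\<forall>t\<in>U. \<exists>V. open V \<and> t \<in> V \<and> (\<exists>C::real. \<forall>s\<in>V \<inter> U. g s \<le> ennreal C))"

definition conj_snd :: "('t \<Rightarrow> 'm::real_inner \<Rightarrow> ennreal) \<Rightarrow> 't \<Rightarrow> 'm \<Rightarrow> ereal" where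
  "conj_snd f t \<xi> = (SUP p. ereal (\<xi> \<bullet> p) - enn2ereal (f t p))"

definition BB_admissible ::
    "'t::topological_space set \<Rightarrow> ('t \<Rightarrow> 'm::euclidean_space \<Rightarrow> ennreal) \<Rightarrow> ('t \<Rightarrow> 'm \<times> real) set" where
  "BB_admissible U f =
     {\<phi> \<in> C0_on U. \<forall>t\<in>U. conj_snd f t (fst (\<phi> t)) + ereal (snd (\<phi> t)) \<le> 0}"

definition BB_functional ::
    "'t::topological_space set \<Rightarrow> ('t \<Rightarrow> 'm::euclidean_space \<Rightarrow> ennreal)
      \<Rightarrow> ('t set \<Rightarrow> 'm \<times> real) \<Rightarrow> ereal" where
  "BB_functional U f \<nu> =
     (SUP \<phi>\<in>BB_admissible U f.
        ereal (vector_integral U (\<lambda>A. fst (\<nu> A)) (\<lambda>t. fst (\<phi> t))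
             + vector_integral U (\<lambda>A. snd (\<nu> A)) (\<lambda>t. snd (\<phi> t))))"

definition F_tilde ::
    "'d::euclidean_space set \<Rightarrow> ('d \<times> 's \<Rightarrow> 'm \<Rightarrow> ennreal) \<Rightarrow> ('d \<Rightarrow> 's) \<Rightarrow> ('d \<Rightarrow> 'm) \<Rightarrow> ennreal" where
  "F_tilde \<Omega> f u p = (\<integral>\<^sup>+x. f (x, u x) (p x) \<partial>lebesgue_on \<Omega>)"

end

theory Submission
  imports Defs
begin

text \<open>
  Since \<open>\<mu> = \<delta>\<^sub>u\<close> and \<open>E = p \<delta>\<^sub>u\<close>, the functional is the supremum of
  \<open>\<integral>\<^sub>\<Omega> \<langle>\<phi>\<^sup>\<xi>(x, u x), p x\<rangle> + \<phi>\<^sup>\<lambda>(x, u x) dx\<close> over continuous fields \<open>\<phi>\<close> whose value at \<open>t\<close> is an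
  affine minorant of \<open>f t\<close>, so \<open>\<le>\<close> holds pointwise.  For \<open>\<ge>\<close>, lower semicontinuity of \<open>f\<close> together
  with the local bound on \<open>f t 0\<close> makes the set of affine minorants of \<open>f t\<close> lower hemicontinuous in \<open>t\<close>.
  By Lusin's theorem \<open>u\<close>, \<open>p\<close> and \<open>x \<mapsto> f (x, u x) (p x)\<close> are continuous on a large compact
  \<open>C \<subseteq> \<Omega>\<close>; the multifunction stays lower hemicontinuous when, over the graph of \<open>u\<close> on \<open>C\<close>, one keeps only
  the minorants that are nearly exact at \<open>p x\<close>, and Michael's theorem gives a continuous selection.
  Because \<open>0\<close> is an affine minorant of \<open>f \<ge> 0\<close>, the selection may be cut off near \<open>C\<close>.
\<close>

section \<open>Continuous selections\<close>

text \<open>Lower hemicontinuity in metric form: for every open \<open>V\<close>, the points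
  \<open>t\<close> whose value \<open>\<Phi> t\<close> meets \<open>V\<close> form a relatively open
  subset of \<open>T\<close>.\<close>

definition lhc_on :: "'a::metric_space set \<Rightarrow> ('a \<Rightarrow> 'b::metric_space set) \<Rightarrow> bool" where
  "lhc_on T \<Phi> \<longleftrightarrow>
     (\<forall>t\<in>T. \<forall>v\<in>\<Phi> t. \<forall>e>0. \<exists>d>0. \<forall>s\<in>T. dist s t < d \<longrightarrow> (\<exists>w\<in>\<Phi> s. dist w v < e))"

lemma lhc_on_subset:
  assumes "lhc_on U \<Phi>" "T \<subseteq> U"
  shows "lhc_on T \<Phi>"
  unfolding lhc_on_def
proof (intro ballI allI impI)
  fix t v and e :: real
  assume "t \<in> T" "v \<in> \<Phi> t" "e > 0"
  then obtain d where "d > 0" "\<forall>s\<in>U. dist s t < d \<longrightarrow> (\<exists>w\<in>\<Phi> s. dist w v < e)"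
    using assms unfolding lhc_on_def by (meson subsetD)
  then show "\<exists>d>0. \<forall>s\<in>T. dist s t < d \<longrightarrow> (\<exists>w\<in>\<Phi> s. dist w v < e)"
    using assms(2) by blast
qed

text \<open>The thickening is the Minkowski sum of \<open>S\<close> and an open ball.\<close>

lemma convex_thickening:
  fixes S :: "'a::real_normed_vector set"
  assumes "convex S"
  shows "convex {v. \<exists>w\<in>S. dist v w < e}"
proof -
  have "{v. \<exists>w\<in>S. dist v w < e} = (\<Union>x\<in>S. \<Union>y\<in>ball 0 e. {x + y})"
  proof (intro equalityI subsetI)
    fix v assume "v \<in> {v. \<exists>w\<in>S. dist v w < e}"
    then obtain w where "w \<in> S" "dist v w < e" by auto
    then show "v \<in> (\<Union>x\<in>S. \<Union>y\<in>ball 0 e. {x + y})"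
      by (intro UN_I[of w] UN_I[of "v - w"]) (auto simp: dist_norm norm_minus_commute)
  next
    fix v assume "v \<in> (\<Union>x\<in>S. \<Union>y\<in>ball 0 e. {x + y})"
    then obtain x y where "x \<in> S" "norm y < e" "v = x + y" by auto
    then show "v \<in> {v. \<exists>w\<in>S. dist v w < e}"
      by (auto simp: dist_norm intro!: bexI[of _ x])
  qed
  then show ?thesis
    using convex_sums[OF assms convex_ball] by simp
qed

text \<open>Partition of unity: a value \<open>v t\<close> chosen at \<open>t\<close> stays within
  \<open>e\<close> of \<open>\<Phi> s\<close> for \<open>s\<close> near \<open>t\<close>. Finitely
  many such neighbourhoods cover \<open>T\<close>, and averages of the nearby \<open>v i\<close>
  stay in the convex \<open>e\<close>-thickening of \<open>\<Phi> s\<close>.\<close>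

lemma approximate_continuous_selection:
  fixes \<Phi> :: "'a::metric_space \<Rightarrow> 'b::real_normed_vector set"
  assumes "compact T" and lhc: "lhc_on T \<Phi>"
    and ne: "\<And>t. t \<in> T \<Longrightarrow> \<Phi> t \<noteq> {}" and cvx: "\<And>t. t \<in> T \<Longrightarrow> convex (\<Phi> t)"
    and "e > 0"
  obtains g where "continuous_on T g" "\<And>t. t \<in> T \<Longrightarrow> \<exists>w\<in>\<Phi> t. dist (g t) w < e"
proof -
  have "\<exists>v. \<forall>t\<in>T. v t \<in> \<Phi> t"
    using ne by (intro bchoice) auto
  then obtain v where v: "\<And>t. t \<in> T \<Longrightarrow> v t \<in> \<Phi> t" by blast
  have "\<forall>t\<in>T. \<exists>d>0. \<forall>s\<in>T. dist s t < d \<longrightarrow> (\<exists>w\<in>\<Phi> s. dist w (v t) < e)"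
    using lhc v \<open>e > 0\<close> unfolding lhc_on_def by blast
  then obtain d where d: "\<And>t. t \<in> T \<Longrightarrow> d t > 0"
      "\<And>t s. \<lbrakk>t \<in> T; s \<in> T; dist s t < d t\<rbrakk> \<Longrightarrow> \<exists>w\<in>\<Phi> s. dist w (v t) < e"
    by metis
  have "T \<subseteq> (\<Union>t\<in>T. ball t (d t))"
    using d by force
  then obtain I where I: "I \<subseteq> T" "finite I" "T \<subseteq> (\<Union>t\<in>I. ball t (d t))"
    using \<open>compact T\<close> compactE_image[of T T "\<lambda>t. ball t (d t)"] by (metis open_ball)
  \<comment> \<open>\<open>c i\<close> is a tent function, positive exactly on the ball of radius
    \<open>d i\<close> about \<open>i\<close>; division by \<open>W\<close> makes the weights sum to
    1.\<close>
  define c where "c = (\<lambda>i s. max 0 (d i - dist s i))"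
  define W where "W = (\<lambda>s. \<Sum>i\<in>I. c i s)"
  define g where "g = (\<lambda>s. \<Sum>i\<in>I. (c i s / W s) *\<^sub>R v i)"
  have c0: "c i s \<ge> 0" for i s by (simp add: c_def)
  have W: "W s > 0" if s: "s \<in> T" for s
  proof -
    obtain i where i: "i \<in> I" "dist i s < d i" using I s by auto
    then have "c i s > 0" by (simp add: c_def dist_commute)
    then show ?thesis unfolding W_def using i I c0 by (intro sum_pos2[of I i]) auto
  qed
  show thesis
  proof
    have cc: "continuous_on T (c i)" for i unfolding c_def by (intro continuous_intros)
    have "continuous_on T W" unfolding W_def by (intro continuous_intros cc)
    then show "continuous_on T g" unfolding g_def using W
      by (intro continuous_intros cc) (auto simp: less_imp_neq[symmetric])
  next
    fix s assume s: "s \<in> T"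
    \<comment> \<open>Only centres whose ball contains \<open>s\<close> carry weight, and for these
      \<open>v i\<close> is close to \<open>\<Phi> s\<close>.\<close>
    define J where "J = {i\<in>I. dist s i < d i}"
    have J: "finite J" "J \<subseteq> I" using I by (auto simp: J_def)
    have z: "c i s = 0" if "i \<in> I - J" for i using that by (auto simp: J_def c_def)
    have g: "g s = (\<Sum>i\<in>J. (c i s / W s) *\<^sub>R v i)"
      unfolding g_def using z J I by (intro sum.mono_neutral_right) auto
    have "(\<Sum>i\<in>J. c i s) = W s"
      unfolding W_def using z J I by (intro sum.mono_neutral_left) auto
    then have one: "(\<Sum>i\<in>J. c i s / W s) = 1"
      using W[OF s] by (simp flip: sum_divide_distrib)
    have "g s \<in> {v. \<exists>w\<in>\<Phi> s. dist v w < e}"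
      unfolding g using J one c0 W[OF s] convex_thickening[OF cvx[OF s], of e]
    proof (intro convex_sum)
      fix i assume "i \<in> J"
      then have "\<exists>w\<in>\<Phi> s. dist w (v i) < e" using d(2)[of i s] s I by (auto simp: J_def)
      then show "v i \<in> {v. \<exists>w\<in>\<Phi> s. dist v w < e}" by (auto simp: dist_commute)
    qed (auto simp: less_imp_le)
    then show "\<exists>w\<in>\<Phi> s. dist (g s) w < e" by simp
  qed
qed

lemma lhc_on_inter_ball:
  assumes lhc: "lhc_on T \<Phi>" and g: "continuous_on T g"
  shows "lhc_on T (\<lambda>t. {w\<in>\<Phi> t. dist w (g t) < r})"
  unfolding lhc_on_def
proof (intro ballI allI impI)
  fix t v and e :: real
  assume t: "t \<in> T" and v: "v \<in> {w\<in>\<Phi> t. dist w (g t) < r}" and "e > 0"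
  \<comment> \<open>Half of the slack in \<open>dist v (g t) < r\<close> pays for replacing
    \<open>v\<close> by \<open>w\<close>, the other half for the variation of
    \<open>g\<close>.\<close>
  define a where "a = min e ((r - dist v (g t)) / 2)"
  have a: "a > 0" "a \<le> e" "2 * a \<le> r - dist v (g t)" using v \<open>e > 0\<close> by (auto simp: a_def min_def field_simps)
  obtain d1 where d1: "d1 > 0" "\<And>s. \<lbrakk>s \<in> T; dist s t < d1\<rbrakk> \<Longrightarrow> \<exists>w\<in>\<Phi> s. dist w v < a"
    using lhc t v a unfolding lhc_on_def by blast
  obtain d2 where d2: "d2 > 0" "\<And>s. \<lbrakk>s \<in> T; dist s t < d2\<rbrakk> \<Longrightarrow> dist (g s) (g t) < a"
    using g t a unfolding continuous_on_iff by blast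
  show "\<exists>d>0. \<forall>s\<in>T. dist s t < d \<longrightarrow> (\<exists>w\<in>{w \<in> \<Phi> s. dist w (g s) < r}. dist w v < e)"
  proof (intro exI[of _ "min d1 d2"] conjI ballI impI)
    fix s assume s: "s \<in> T" "dist s t < min d1 d2"
    obtain w where w: "w \<in> \<Phi> s" "dist w v < a" using d1 s by auto
    have "dist w (g s) \<le> dist w v + dist v (g t) + dist (g t) (g s)"
      by (meson add_mono dist_triangle order_refl order_trans)
    also have "\<dots> < r" using w d2(2)[of s] s a by (simp add: dist_commute)
    finally show "\<exists>w\<in>{w \<in> \<Phi> s. dist w (g s) < r}. dist w v < e" using w a by force
  qed (use d1 d2 in auto)
qed

text \<open>Approximate selections are refined successively: each new one approximates the part of
  \<open>\<Phi> t\<close> in a shrinking ball around the previous one, so they converge uniformly.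
  The values need not be closed, hence the limit lies in their closures.\<close>

theorem michael_selection_compact:
  fixes \<Phi> :: "'a::metric_space \<Rightarrow> 'b::banach set"
  assumes "compact T" and lhc: "lhc_on T \<Phi>"
    and ne: "\<And>t. t \<in> T \<Longrightarrow> \<Phi> t \<noteq> {}" and cvx: "\<And>t. t \<in> T \<Longrightarrow> convex (\<Phi> t)"
  obtains g where "continuous_on T g" "\<And>t. t \<in> T \<Longrightarrow> g t \<in> closure (\<Phi> t)"
proof -
  define P where "P = (\<lambda>n g. continuous_on T g \<and> (\<forall>t\<in>T. \<exists>w\<in>\<Phi> t. dist (g t) w < (1/2::real)^n))"
  \<comment> \<open>The factor 2 covers \<open>(1/2)^n + (1/2)^Suc n\<close>, the bound for the
    distance of consecutive selections.\<close>
  define Q where "Q = (\<lambda>(n::nat) (g :: 'a \<Rightarrow> 'b) h. \<forall>t\<in>T. dist (h t) (g t) \<le> 2 * (1/2::real)^n)"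
  have "\<exists>G. \<forall>n. P n (G n) \<and> Q n (G n) (G (Suc n))"
  proof (rule dependent_nat_choice)
    show "\<exists>g. P 0 g"
      using approximate_continuous_selection[OF assms, of 1] unfolding P_def by (metis power_0 zero_less_one)
  next
    fix g n assume g: "P n g"
    \<comment> \<open>Nonempty, since \<open>P n g\<close> puts a point of \<open>\<Phi> t\<close>
      that close to \<open>g t\<close>.\<close>
    let ?\<Psi> = "\<lambda>t. {w\<in>\<Phi> t. dist w (g t) < (1/2)^n}"
    obtain h where h: "continuous_on T h" "\<And>t. t \<in> T \<Longrightarrow> \<exists>w\<in>?\<Psi> t. dist (h t) w < (1/2)^Suc n"
    proof (rule approximate_continuous_selection[OF \<open>compact T\<close>, of ?\<Psi> "(1/2)^Suc n"])
      show "lhc_on T ?\<Psi>" using g lhc unfolding P_def by (intro lhc_on_inter_ball) auto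
      fix t assume t: "t \<in> T"
      show "?\<Psi> t \<noteq> {}" using g t unfolding P_def by (auto simp: dist_commute)
      have "?\<Psi> t = \<Phi> t \<inter> ball (g t) ((1/2)^n)" by (auto simp: dist_commute)
      then show "convex (?\<Psi> t)" using cvx[OF t] by (simp add: convex_Int)
    qed auto
    have "P (Suc n) h" using h unfolding P_def by blast
    moreover have "Q n g h" unfolding Q_def
    proof
      fix t assume "t \<in> T"
      then obtain w where w: "dist w (g t) < (1/2)^n" "dist (h t) w < (1/2)^Suc n" using h by blast
      have "dist (h t) (g t) \<le> dist (h t) w + dist w (g t)" by (rule dist_triangle)
      moreover have "(1/2::real)^Suc n \<le> (1/2)^n" by simp
      ultimately show "dist (h t) (g t) \<le> 2 * (1/2::real)^n" using w by linarith
    qed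
    ultimately show "\<exists>h. P (Suc n) h \<and> Q n g h" by blast
  qed
  then obtain G where G: "\<And>n. P n (G n)" "\<And>n. Q n (G n) (G (Suc n))" by blast
  \<comment> \<open>The limit is written as a telescoping series, so that the M-test gives uniform
    convergence.\<close>
  let ?S = "\<lambda>t. \<Sum>n. G (Suc n) t - G n t"
  have "uniform_limit T (\<lambda>n t. \<Sum>i<n. G (Suc i) t - G i t) ?S sequentially"
  proof (rule Weierstrass_m_test[where M = "\<lambda>n. 2 * (1/2::real)^n"])
    show "norm (G (Suc n) t - G n t) \<le> 2 * (1/2)^n" if "t \<in> T" for n t
      using G(2)[of n] that by (simp add: Q_def dist_norm)
    show "summable (\<lambda>n. 2 * (1/2::real)^n)"
      by (intro summable_mult summable_geometric) auto
  qed
  then have lim: "uniform_limit T (\<lambda>n t. (\<Sum>i<n. G (Suc i) t - G i t) + G 0 t) (\<lambda>t. ?S t + G 0 t) sequentially"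
    by (intro uniform_limit_intros)
  moreover have "(\<Sum>i<n. G (Suc i) t - G i t) + G 0 t = G n t" for n t
    using sum_lessThan_telescope[of "\<lambda>i. G i t" n] by (metis diff_add_cancel)
  ultimately have lim: "uniform_limit T G (\<lambda>t. ?S t + G 0 t) sequentially" by simp
  show thesis
  proof
    show "continuous_on T (\<lambda>t. ?S t + G 0 t)"
      using lim G(1) by (intro uniform_limit_theorem[OF _ lim]) (auto simp: P_def)
    fix t assume t: "t \<in> T"
    show "?S t + G 0 t \<in> closure (\<Phi> t)"
      unfolding closure_approachable
    proof (intro allI impI)
      fix e :: real assume "e > 0"
      have "\<forall>\<^sub>F n in sequentially. dist (G n t) (?S t + G 0 t) < e / 2"
        using tendsto_uniform_limitI[OF lim t] \<open>e > 0\<close> by (intro tendstoD) auto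
      moreover have "(\<lambda>n. (1/2::real)^n) \<longlonglongrightarrow> 0" by (intro LIMSEQ_power_zero) auto
      then have "\<forall>\<^sub>F n in sequentially. (1/2::real)^n < e / 2"
        using \<open>e > 0\<close> by (intro order_tendstoD) auto
      ultimately have "\<forall>\<^sub>F n in sequentially. dist (G n t) (?S t + G 0 t) < e / 2 \<and> (1/2::real)^n < e / 2"
        by (rule eventually_conj)
      then obtain n where n: "dist (G n t) (?S t + G 0 t) < e / 2" "(1/2::real)^n < e / 2"
        unfolding eventually_sequentially by blast
      obtain w where "w \<in> \<Phi> t" "dist (G n t) w < (1/2)^n" using G(1)[of n] t unfolding P_def by blast
      then show "\<exists>w\<in>\<Phi> t. dist w (?S t + G 0 t) < e"
        using n dist_triangle3[of w "?S t + G 0 t" "G n t"] by (intro bexI[of _ w]) auto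
    qed
  qed
qed

section \<open>Affine minorants\<close>

text \<open>A pair \<open>(\<xi>, l)\<close> encodes the function
  \<open>q \<mapsto> \<xi> \<bullet> q + l\<close>. \<open>ennreal\<close> truncates it at 0, which
  does not change the inequality since \<open>g \<ge> 0\<close>.\<close>

definition affine_minorants :: "('m::real_inner \<Rightarrow> ennreal) \<Rightarrow> ('m \<times> real) set" where
  "affine_minorants g = {v. \<forall>q. ennreal (fst v \<bullet> q + snd v) \<le> g q}"

lemma affine_minorantsD: "v \<in> affine_minorants g \<Longrightarrow> ennreal (fst v \<bullet> q + snd v) \<le> g q"
  by (simp add: affine_minorants_def)

lemma zero_in_affine_minorants: "0 \<in> affine_minorants g"
  by (simp add: affine_minorants_def)

text \<open>Truncation by \<open>ennreal\<close> is not linear, so the combined affine function is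
  bounded by the larger of the two values, which \<open>g q\<close> dominates.\<close>

lemma convex_affine_minorants: "convex (affine_minorants g)"
proof (rule convexI)
  fix v w and a b :: real
  assume v: "v \<in> affine_minorants g" and w: "w \<in> affine_minorants g" and ab: "0 \<le> a" "0 \<le> b" "a + b = 1"
  show "a *\<^sub>R v + b *\<^sub>R w \<in> affine_minorants g"
    unfolding affine_minorants_def
  proof (intro CollectI allI)
    fix q
    let ?x = "fst v \<bullet> q + snd v" and ?y = "fst w \<bullet> q + snd w"
    have "fst (a *\<^sub>R v + b *\<^sub>R w) \<bullet> q + snd (a *\<^sub>R v + b *\<^sub>R w) = a * ?x + b * ?y"
      by (simp add: algebra_simps inner_add_left)
    also have "\<dots> \<le> max ?x ?y"
      using ab by (intro convex_bound_le) auto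
    finally have "ennreal (fst (a *\<^sub>R v + b *\<^sub>R w) \<bullet> q + snd (a *\<^sub>R v + b *\<^sub>R w)) \<le> ennreal (max ?x ?y)"
      by (rule ennreal_leI)
    also have "\<dots> \<le> g q"
      using affine_minorantsD[OF v, of q] affine_minorantsD[OF w, of q] by (simp add: max_def)
    finally show "ennreal (fst (a *\<^sub>R v + b *\<^sub>R w) \<bullet> q + snd (a *\<^sub>R v + b *\<^sub>R w)) \<le> g q" .
  qed
qed

lemma closed_affine_minorants: "closed (affine_minorants g)"
proof -
  have "closed {v. ennreal (fst v \<bullet> q + snd v) \<le> g q}" for q
    by (intro closed_Collect_le continuous_on_ennreal continuous_intros)
  then have "closed (\<Inter>q. {v. ennreal (fst v \<bullet> q + snd v) \<le> g q})" by blast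
  also have "(\<Inter>q. {v. ennreal (fst v \<bullet> q + snd v) \<le> g q}) = affine_minorants g"
    by (auto simp: affine_minorants_def)
  finally show ?thesis .
qed

text \<open>The supremum in the conjugate is at most \<open>- l\<close> iff each term is, and each
  term is one instance of the minorant inequality. As \<open>l\<close> is finite, it can be moved
  across even when the conjugate is infinite.\<close>

lemma conj_snd_le_iff:
  "conj_snd f t \<xi> + ereal l \<le> 0 \<longleftrightarrow> (\<xi>, l) \<in> affine_minorants (f t)"
proof -
  have *: "(ereal x - enn2ereal y \<le> ereal (- l)) \<longleftrightarrow> ennreal (x + l) \<le> y" for x y
  proof (cases y)
    case (real r)
    then show ?thesis by (auto simp: ennreal_le_iff)
  qed (simp add: top_ereal_def)
  have "conj_snd f t \<xi> + ereal l \<le> 0 \<longleftrightarrow> conj_snd f t \<xi> \<le> ereal (- l)"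
    by (cases "conj_snd f t \<xi>") auto
  also have "\<dots> \<longleftrightarrow> (\<forall>p. ereal (\<xi> \<bullet> p) - enn2ereal (f t p) \<le> ereal (- l))"
    by (simp add: conj_snd_def SUP_le_iff)
  finally show ?thesis by (simp add: * affine_minorants_def)
qed

section \<open>Epigraphs and separation\<close>

lemma closed_epigraph:
  fixes g :: "'m::metric_space \<Rightarrow> ennreal"
  assumes "lsc_on UNIV g"
  shows "closed {z. 0 \<le> snd z \<and> g (fst z) \<le> ennreal (snd z)}" (is "closed ?E")
proof -
  have "open (- ?E)"
  proof (subst open_subopen, intro ballI)
    fix z assume z: "z \<in> - ?E"
    show "\<exists>T. open T \<and> z \<in> T \<and> T \<subseteq> - ?E"
    \<comment> \<open>Negative heights are treated apart: \<open>ennreal\<close> sends them to 0, so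
      without \<open>0 \<le> snd z\<close> they would count as epigraph points wherever
      \<open>g\<close> vanishes.\<close>
    proof (cases "snd z < 0")
      case True
      then show ?thesis
        by (intro exI[of _ "snd -` {..<0}"]) (auto intro!: open_vimage continuous_intros)
    next
      case False
      then have "ennreal (snd z) < g (fst z)" using z by auto
      \<comment> \<open>Lower semicontinuity keeps \<open>g\<close> above the intermediate level
        \<open>y\<close> nearby, and heights below \<open>r\<close> stay under it.\<close>
      then obtain y where y: "ennreal (snd z) < y" "y < g (fst z)" using dense by blast
      then obtain r where r: "y = ennreal r" "r \<ge> 0" by (cases y) auto
      have sr: "snd z < r" using y r False by (simp add: ennreal_less_iff)
      have "\<forall>\<^sub>F q in at (fst z). y < g q"
        using assms y by (simp add: lsc_on_def)
      then obtain V where V: "open V" "fst z \<in> V" "\<And>q. q \<in> V \<Longrightarrow> q \<noteq> fst z \<Longrightarrow> y < g q"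
        unfolding eventually_at_topological by blast
      have "V \<times> {..<r} \<subseteq> - ?E"
      proof safe
        fix q s assume "q \<in> V" "s < r" "0 \<le> snd (q, s)" and le: "g (fst (q, s)) \<le> ennreal (snd (q, s))"
        have "y < g q" using V y \<open>q \<in> V\<close> by (cases "q = fst z") auto
        also have "g q \<le> ennreal s" using le by simp
        also have "\<dots> \<le> y" using \<open>s < r\<close> r by (simp add: ennreal_leI)
        finally show False by simp
      qed
      then show ?thesis using V sr
        by (intro exI[of _ "V \<times> {..<r}"]) (auto intro: open_Times simp: mem_Times_iff)
    qed
  qed
  then show ?thesis by (simp add: closed_def)
qed

lemma convex_epigraph:
  assumes "ennreal_convex g"
  shows "convex {z. 0 \<le> snd z \<and> g (fst z) \<le> ennreal (snd z)}"
proof (rule convexI)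
  fix z w and a b :: real
  assume z: "z \<in> {z. 0 \<le> snd z \<and> g (fst z) \<le> ennreal (snd z)}"
    and w: "w \<in> {z. 0 \<le> snd z \<and> g (fst z) \<le> ennreal (snd z)}"
    and ab: "0 \<le> a" "0 \<le> b" "a + b = 1"
  have "g (a *\<^sub>R fst z + b *\<^sub>R fst w) \<le> ennreal a * g (fst z) + ennreal b * g (fst w)"
    using assms ab unfolding ennreal_convex_def by blast
  also have "\<dots> \<le> ennreal a * ennreal (snd z) + ennreal b * ennreal (snd w)"
    using z w by (intro add_mono mult_left_mono) auto
  also have "\<dots> = ennreal (a * snd z + b * snd w)"
    using z w ab by (simp add: ennreal_mult)
  finally show "a *\<^sub>R z + b *\<^sub>R w \<in> {z. 0 \<le> snd z \<and> g (fst z) \<le> ennreal (snd z)}"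
    using z w ab by simp
qed

text \<open>Fenchel--Moreau. Since \<open>g \<ge> 0\<close>, a vertical separating hyperplane can be scaled to give an
  affine minorant.\<close>

lemma affine_minorant_above:
  fixes g :: "'m::euclidean_space \<Rightarrow> ennreal"
  assumes lsc: "lsc_on UNIV g" and cvx: "ennreal_convex g" and c: "c < 0 \<or> ennreal c < g q"
  obtains v where "v \<in> affine_minorants g" "c < fst v \<bullet> q + snd v"
proof (cases "c < 0")
  case True
  then show ?thesis using that[OF zero_in_affine_minorants] by simp
next
  case False
  let ?E = "{z. 0 \<le> snd z \<and> g (fst z) \<le> ennreal (snd z)}"
  have qc: "(q, c) \<notin> ?E" using False c by auto
  then obtain n \<beta> where n: "n \<bullet> (q, c) < \<beta>" "\<And>z. z \<in> ?E \<Longrightarrow> \<beta> < n \<bullet> z"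
    using separating_hyperplane_closed_point[OF convex_epigraph[OF cvx] closed_epigraph[OF lsc] qc] by blast
  obtain a b where ab: "n = (a, b)" by (cases n)
  have sep: "a \<bullet> q + b * c < \<beta>" using n ab by simp
  have epi: "\<beta> < a \<bullet> y + b * r" if "g y \<le> ennreal r" "r \<ge> 0" for y r
    using n(2)[of "(y, r)"] that ab by simp
  show ?thesis
  proof (cases "\<exists>y. g y \<noteq> top")
    case False
    then show ?thesis using that[of "(0, c + 1)"] by (simp add: affine_minorants_def)
  next
    case True
    then obtain y r where yr: "g y = ennreal r" "r \<ge> 0" by (metis ennreal_cases)
    \<comment> \<open>Epigraph points can be raised indefinitely, so a negative \<open>b\<close>
      would carry them across the hyperplane.\<close>
    have "b \<ge> 0"
    proof (rule ccontr)
      assume b: "\<not> b \<ge> 0"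
      define s where "s = max r ((\<beta> - a \<bullet> y) / b)"
      have "\<beta> < a \<bullet> y + b * s" using yr by (intro epi) (auto simp: s_def intro: ennreal_leI)
      moreover have "b * s \<le> b * ((\<beta> - a \<bullet> y) / b)" using b by (intro mult_left_mono_neg) (auto simp: s_def)
      ultimately show False using b by simp
    qed
    show ?thesis
    proof (cases "b = 0")
      case False
      then have b: "b > 0" using \<open>b \<ge> 0\<close> by simp
      \<comment> \<open>Solving \<open>a \<bullet> x + b * r = \<beta>\<close> for the height
        \<open>r\<close> gives the affine function.\<close>
      show ?thesis
      proof (rule that[of "(- (1 / b) *\<^sub>R a, \<beta> / b)"])
        show "c < fst (- (1 / b) *\<^sub>R a, \<beta> / b) \<bullet> q + snd (- (1 / b) *\<^sub>R a, \<beta> / b)"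
          using sep b by (simp add: field_simps)
        have "ennreal (- (a \<bullet> x) / b + \<beta> / b) \<le> g x" for x
        proof (cases "g x")
          case (real s)
          then have "\<beta> < a \<bullet> x + b * s" using epi by simp
          then show ?thesis using b real by (simp add: ennreal_leI field_simps)
        qed simp
        then show "(- (1 / b) *\<^sub>R a, \<beta> / b) \<in> affine_minorants g"
          by (simp add: affine_minorants_def)
      qed
    next
      case True
      then have pos: "\<beta> - a \<bullet> q > 0" using sep by simp
      \<comment> \<open>In the vertical case \<open>\<beta> - a \<bullet> x\<close> is negative
        wherever \<open>g x\<close> is finite and positive at \<open>q\<close>; \<open>k\<close>
        scales its value at \<open>q\<close> to \<open>\<bar>c\<bar> + 1\<close>, above
        \<open>c\<close>.\<close>
      define k where "k = (\<bar>c\<bar> + 1) / (\<beta> - a \<bullet> q)"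
      have k: "k > 0" "k * (\<beta> - a \<bullet> q) = \<bar>c\<bar> + 1" using pos by (auto simp: k_def)
      show ?thesis
      proof (rule that[of "(- k *\<^sub>R a, k * \<beta>)"])
        show "c < fst (- k *\<^sub>R a, k * \<beta>) \<bullet> q + snd (- k *\<^sub>R a, k * \<beta>)"
          using k by (simp add: algebra_simps)
        have "ennreal (- (k * (a \<bullet> x)) + k * \<beta>) \<le> g x" for x
        proof (cases "g x")
          case (real s)
          then have "\<beta> < a \<bullet> x" using epi[of x s] True by simp
          then have "- (k * (a \<bullet> x)) + k * \<beta> \<le> 0" using k by simp
          then show ?thesis by (simp add: ennreal_neg)
        qed simp
        then show "(- k *\<^sub>R a, k * \<beta>) \<in> affine_minorants g"
          by (simp add: affine_minorants_def)
      qed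
    qed
  qed
qed

section \<open>Lower hemicontinuity of the affine minorants\<close>

lemma lsc_on_section:
  assumes "lsc_on (U \<times> UNIV) (\<lambda>(t, q). f t q)" "t \<in> U"
  shows "lsc_on UNIV (f t)"
  unfolding lsc_on_def
proof (intro ballI allI impI)
  fix q y assume "y < f t q"
  then have "\<forall>\<^sub>F z in at (t, q) within U \<times> UNIV. y < (case z of (t, q) \<Rightarrow> f t q)"
    using assms unfolding lsc_on_def by auto
  then obtain V where V: "open V" "(t, q) \<in> V" "\<forall>z\<in>V. z \<noteq> (t, q) \<longrightarrow> z \<in> U \<times> UNIV \<longrightarrow> y < (case z of (t, q) \<Rightarrow> f t q)"
    unfolding eventually_at_topological by blast
  have "open (Pair t -` V)" using V(1) by (intro open_vimage continuous_intros)
  then show "\<forall>\<^sub>F z in at q. y < f t z"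
    unfolding eventually_at_topological using V \<open>t \<in> U\<close> by (intro exI[of _ "Pair t -` V"]) auto
qed

lemma lsc_on_sequentially:
  fixes x :: "nat \<Rightarrow> 'a::metric_space"
  assumes lsc: "lsc_on S g" and x: "\<And>n. x n \<in> S" "x \<longlonglongrightarrow> a" and "a \<in> S" "y < g a"
  shows "\<forall>\<^sub>F n in sequentially. y < g (x n)"
proof -
  have "\<forall>\<^sub>F z in at a within S. y < g z"
    using lsc assms(4,5) by (auto simp: lsc_on_def)
  \<comment> \<open>The filter \<open>at a within S\<close> leaves out \<open>a\<close> itself;
    \<open>y < g a\<close> fills the gap, so terms with \<open>x n = a\<close> are harmless.\<close>
  then have "\<forall>\<^sub>F z in nhds a. z \<in> S \<longrightarrow> y < g z"
    using \<open>y < g a\<close> by (auto simp: eventually_at_filter elim!: eventually_mono)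
  then show ?thesis
    using x by (auto simp: filterlim_iff dest!: spec)
qed

text \<open>If \<open>w\<close> is the projection of \<open>v\<close> onto the affine minorants of \<open>g\<close> and \<open>(a, b)\<close> the unit normal
  at \<open>w\<close> pointing towards \<open>v\<close>, then biduality turns the support inequality into a bound on \<open>g\<close> itself.
  Adding \<open>s > 0\<close> to \<open>b\<close>, at the cost of \<open>s * C\<close>, avoids vertical normals.\<close>

lemma far_from_affine_minorants:
  fixes g :: "'m::euclidean_space \<Rightarrow> ennreal"
  assumes lsc: "lsc_on UNIV g" and cvx: "ennreal_convex g" and C: "g 0 \<le> ennreal C" "C \<ge> 0"
    and far: "\<And>w. w \<in> affine_minorants g \<Longrightarrow> e \<le> dist w v" and "e > 0" "s > 0"
  obtains n where "norm n = 1" "snd n \<ge> 0"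
    "(v \<bullet> n - e + s * C) / (snd n + s) \<ge> 0"
    "g (fst n /\<^sub>R (snd n + s)) \<le> ennreal ((v \<bullet> n - e + s * C) / (snd n + s))"
proof -
  let ?K = "affine_minorants g"
  define w where "w = closest_point ?K v"
  have wK: "w \<in> ?K"
    unfolding w_def using closest_point_in_set[OF closed_affine_minorants] zero_in_affine_minorants by blast
  define n where "n = (v - w) /\<^sub>R norm (v - w)"
  have nz: "norm (v - w) \<ge> e"
    using far[OF wK] by (simp add: dist_norm norm_minus_commute)
  then have nz0: "norm (v - w) > 0" using \<open>e > 0\<close> by linarith
  have supp: "z \<bullet> n \<le> w \<bullet> n" if "z \<in> ?K" for z
  proof -
    have "(v - w) \<bullet> (z - w) \<le> 0"
      unfolding w_def using closest_point_dot[OF convex_affine_minorants closed_affine_minorants that] .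
    then have "(z - w) \<bullet> n \<le> 0"
      unfolding n_def using nz0 by (simp add: inner_commute mult_nonneg_nonpos)
    then show ?thesis by (simp add: inner_diff_left)
  qed
  have "(v - w) \<bullet> n = norm (v - w)"
    unfolding n_def using nz0 by (simp add: power2_norm_eq_inner[symmetric] power2_eq_square)
  then have wn: "w \<bullet> n \<le> v \<bullet> n - e"
    using nz by (simp add: inner_diff_left)
  \<comment> \<open>Lowering the constant of \<open>w\<close> gives another minorant; the support
    inequality for it yields the sign.\<close>
  have b: "snd n \<ge> 0"
  proof -
    have "ennreal (fst w \<bullet> q + (snd w - 1)) \<le> g q" for q
      by (rule order_trans[OF ennreal_leI affine_minorantsD[OF wK, of q]]) simp
    then have "(fst w, snd w - 1) \<in> ?K"
      by (simp add: affine_minorants_def)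
    from supp[OF this] show ?thesis by (simp add: inner_prod_def algebra_simps)
  qed
  let ?c = "(v \<bullet> n - e + s * C) / (snd n + s)"
  have pos: "snd n + s > 0" using b \<open>s > 0\<close> by simp
  \<comment> \<open>At the origin a minorant is at most \<open>C\<close>, so
    \<open>snd z \<le> C\<close>; adding \<open>s\<close> times this to the support inequality turns
    the vertical component into \<open>snd n + s\<close>.\<close>
  have le: "\<not> ?c < fst z \<bullet> (fst n /\<^sub>R (snd n + s)) + snd z" if z: "z \<in> ?K" for z
  proof -
    have "ennreal (snd z) \<le> ennreal C"
      by (rule order_trans[OF _ C(1)]) (use affine_minorantsD[OF z, of 0] in simp)
    then have "snd z \<le> C" using C by (simp add: ennreal_le_iff)
    then have "s * snd z \<le> s * C" using \<open>s > 0\<close> by simp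
    moreover have "fst z \<bullet> fst n + snd z * snd n \<le> v \<bullet> n - e"
      using supp[OF z] wn by (simp add: inner_prod_def)
    ultimately have "fst z \<bullet> fst n + snd z * (snd n + s) \<le> v \<bullet> n - e + s * C"
      by (simp add: algebra_simps)
    moreover have "fst z \<bullet> (fst n /\<^sub>R (snd n + s)) + snd z = (fst z \<bullet> fst n + snd z * (snd n + s)) / (snd n + s)"
      using pos by (simp add: field_simps)
    ultimately show ?thesis using pos by (simp add: divide_right_mono not_less)
  qed
  show thesis
  proof (rule that[OF _ b])
    show "norm n = 1" unfolding n_def using nz0 by simp
    show "0 \<le> ?c" using le[OF zero_in_affine_minorants] by simp
    show "g (fst n /\<^sub>R (snd n + s)) \<le> ennreal ?c"
    proof (rule ccontr)
      assume "\<not> ?thesis"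
      then obtain z where "z \<in> ?K" "?c < fst z \<bullet> (fst n /\<^sub>R (snd n + s)) + snd z"
        using affine_minorant_above[OF lsc cvx, of ?c "fst n /\<^sub>R (snd n + s)"] by (metis not_le)
      then show False using le by blast
    qed
  qed
qed

text \<open>Otherwise some minorant \<open>v\<close> of \<open>f t\<close> stays at distance
  \<open>e\<close> from the minorants of \<open>f (x k)\<close> for a sequence \<open>x k\<close>
  tending to \<open>t\<close>. The unit normals of \<open>far_from_affine_minorants\<close>
  subconverge, and joint lower semicontinuity passes its bound on to \<open>f t\<close>, too low for
  \<open>v\<close> to lie below \<open>f t\<close>.\<close>

lemma lhc_on_affine_minorants:
  fixes f :: "'t::metric_space \<Rightarrow> 'm::euclidean_space \<Rightarrow> ennreal"
  assumes lsc: "lsc_on (U \<times> UNIV) (\<lambda>(t, q). f t q)"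
    and cvx: "\<forall>t\<in>U. ennreal_convex (f t)"
    and bdd: "locally_bounded_on U (\<lambda>t. f t 0)"
  shows "lhc_on U (\<lambda>t. affine_minorants (f t))"
proof (rule ccontr)
  assume "\<not> ?thesis"
  then obtain t v e where t: "t \<in> U" and v: "v \<in> affine_minorants (f t)" and "e > 0"
    and bad: "\<And>d. d > 0 \<Longrightarrow> \<exists>s\<in>U. dist s t < d \<and> (\<forall>w\<in>affine_minorants (f s). e \<le> dist w v)"
    unfolding lhc_on_def by (meson not_le)
  obtain V C where V: "open V" "t \<in> V" "\<And>s. s \<in> V \<inter> U \<Longrightarrow> f s 0 \<le> ennreal C"
    using bspec[OF bdd[unfolded locally_bounded_on_def] t] by blast
  define D where "D = max C 0"
  have D: "D \<ge> 0" "\<And>s. s \<in> V \<inter> U \<Longrightarrow> f s 0 \<le> ennreal D"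
    using V(3) by (auto simp: D_def max_def ennreal_neg)
  obtain r where r: "r > 0" "ball t r \<subseteq> V" using V openE by blast
  \<comment> \<open>Chosen so that \<open>s * (D - snd v) < e\<close>, which the limit will
    contradict; the summand 1 keeps the denominator positive.\<close>
  define s where "s = e / (2 * (\<bar>D - snd v\<bar> + 1))"
  have den: "2 * (\<bar>D - snd v\<bar> + 1) > 0" by (simp add: add_nonneg_pos)
  have s: "s > 0" "s * (D - snd v) < e"
  proof -
    show "s > 0" unfolding s_def by (rule divide_pos_pos[OF \<open>e > 0\<close> den])
    have "s * (D - snd v) \<le> s * (\<bar>D - snd v\<bar> + 1)" using \<open>s > 0\<close> by (intro mult_left_mono) auto
    also have "\<dots> = e / 2" using den by (simp add: s_def divide_simps)
    finally show "s * (D - snd v) < e" using \<open>e > 0\<close> by simp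
  qed
  have "\<forall>k::nat. \<exists>x. x \<in> U \<and> dist x t < min r (inverse (Suc k)) \<and> (\<forall>w\<in>affine_minorants (f x). e \<le> dist w v)"
  proof
    fix k :: nat
    have "min r (inverse (Suc k)) > 0" using r by simp
    from bad[OF this] show "\<exists>x. x \<in> U \<and> dist x t < min r (inverse (Suc k)) \<and> (\<forall>w\<in>affine_minorants (f x). e \<le> dist w v)"
      by blast
  qed
  then obtain x where x: "\<And>k. x k \<in> U" "\<And>k. dist (x k) t < r" "\<And>k. dist (x k) t < inverse (Suc k)"
      "\<And>k w. w \<in> affine_minorants (f (x k)) \<Longrightarrow> e \<le> dist w v"
    by (auto dest!: choice)
  have lim: "x \<longlonglongrightarrow> t"
    unfolding tendsto_iff
  proof (intro allI impI)
    fix a :: real assume "a > 0"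
    then have "\<forall>\<^sub>F k in sequentially. inverse (real (Suc k)) < a"
      using LIMSEQ_inverse_real_of_nat by (intro order_tendstoD) auto
    then show "\<forall>\<^sub>F k in sequentially. dist (x k) t < a"
      by eventually_elim (use x(3) less_trans in blast)
  qed
  let ?c = "\<lambda>n. (v \<bullet> n - e + s * D) / (snd n + s)"
  let ?q = "\<lambda>n. fst n /\<^sub>R (snd n + s)"
  have "\<exists>n. norm n = 1 \<and> snd n \<ge> 0 \<and> ?c n \<ge> 0 \<and> f (x k) (?q n) \<le> ennreal (?c n)" for k
  proof -
    have "x k \<in> V \<inter> U" using x r by (force simp: dist_commute)
    then have "f (x k) 0 \<le> ennreal D" by (rule D(2))
    from far_from_affine_minorants[OF lsc_on_section[OF lsc x(1)] bspec[OF cvx x(1)] this D(1) x(4)[where k = k] \<open>e > 0\<close> s(1)]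
    obtain n where "norm n = 1" "snd n \<ge> 0" "?c n \<ge> 0" "f (x k) (?q n) \<le> ennreal (?c n)"
      by blast
    then show ?thesis by blast
  qed
  then obtain n where n: "\<And>k. norm (n k) = 1" "\<And>k. snd (n k) \<ge> 0" "\<And>k. ?c (n k) \<ge> 0"
      "\<And>k. f (x k) (?q (n k)) \<le> ennreal (?c (n k))"
    by metis
  have "\<And>k. n k \<in> sphere 0 1" using n(1) by simp
  then obtain m \<phi> where m: "m \<in> sphere 0 1" "strict_mono \<phi>" "(n \<circ> \<phi>) \<longlonglongrightarrow> m"
    using compact_sphere[of 0 1] unfolding compact_def by metis
  have nm: "(\<lambda>k. n (\<phi> k)) \<longlonglongrightarrow> m" using m(3) by (simp add: comp_def)
  have "(\<lambda>k. snd (n (\<phi> k))) \<longlonglongrightarrow> snd m" by (intro tendsto_snd nm)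
  then have m0: "snd m \<ge> 0" using n(2) by (intro LIMSEQ_le_const) auto
  \<comment> \<open>\<open>snd m\<close> may be 0; the added \<open>s\<close> keeps the limiting
    denominator positive.\<close>
  then have pos: "snd m + s > 0" using s by simp
  have climit: "(\<lambda>k. ?c (n (\<phi> k))) \<longlonglongrightarrow> ?c m"
    using pos by (intro tendsto_intros nm) auto
  have qlimit: "(\<lambda>k. ?q (n (\<phi> k))) \<longlonglongrightarrow> ?q m"
    using pos by (intro tendsto_intros nm) auto
  have c0: "?c m \<ge> 0" using climit n(3) by (intro LIMSEQ_le_const) auto
  have "f t (?q m) \<le> ennreal (?c m)"
  proof (rule ccontr)
    assume "\<not> ?thesis"
    then have "ennreal (?c m) < f t (?q m)" by (simp add: not_le)
    from dense[OF this] obtain y where y: "ennreal (?c m) < y" "y < f t (?q m)" by blast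
    have "(\<lambda>k. (x (\<phi> k), ?q (n (\<phi> k)))) \<longlonglongrightarrow> (t, ?q m)"
      using LIMSEQ_subseq_LIMSEQ[OF lim m(2)] qlimit by (intro tendsto_Pair) (auto simp: comp_def)
    then have "\<forall>\<^sub>F k in sequentially. y < (\<lambda>(t, q). f t q) (x (\<phi> k), ?q (n (\<phi> k)))"
      using t x(1) y by (intro lsc_on_sequentially[OF lsc]) auto
    moreover have "(\<lambda>k. ennreal (?c (n (\<phi> k)))) \<longlonglongrightarrow> ennreal (?c m)"
      using climit by (intro tendsto_ennrealI)
    then have "\<forall>\<^sub>F k in sequentially. ennreal (?c (n (\<phi> k))) < y"
      using y by (intro order_tendstoD)
    ultimately have "\<forall>\<^sub>F k in sequentially. False"
      by eventually_elim (use n(4) in \<open>metis case_prod_conv less_trans not_le\<close>)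
    then show False by simp
  qed
  \<comment> \<open>Evaluating \<open>v\<close> at \<open>?q m\<close> and clearing the denominator
    gives \<open>e \<le> s * (D - snd v)\<close>.\<close>
  with affine_minorantsD[OF v, of "?q m"] have "ennreal (fst v \<bullet> ?q m + snd v) \<le> ennreal (?c m)"
    by (rule order_trans)
  then have "fst v \<bullet> ?q m + snd v \<le> ?c m" using c0 by (simp add: ennreal_le_iff)
  moreover have "fst v \<bullet> ?q m + snd v = (v \<bullet> m + s * snd v) / (snd m + s)"
    using pos by (simp add: inner_prod_def field_simps)
  ultimately have "v \<bullet> m + s * snd v \<le> v \<bullet> m - e + s * D"
    using pos by (simp add: divide_le_cancel)
  then show False using s by (simp add: algebra_simps)
qed

text \<open>Michael's theorem is applied to the minorants, restricted over the graph of
  \<open>u\<close> on \<open>C\<close> to those above \<open>h x\<close> at \<open>p x\<close>.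
  Lower hemicontinuity survives because the graph is closed and the extra condition is open and
  varies continuously with \<open>x\<close>.\<close>

lemma near_optimal_selection:
  fixes f :: "'d::euclidean_space \<times> 's::euclidean_space \<Rightarrow> 'm::euclidean_space \<Rightarrow> ennreal"
  assumes lsc: "lsc_on ((\<Omega> \<times> \<Gamma>) \<times> UNIV) (\<lambda>(t, q). f t q)"
    and cvx: "\<forall>t\<in>\<Omega> \<times> \<Gamma>. ennreal_convex (f t)"
    and bdd: "locally_bounded_on (\<Omega> \<times> \<Gamma>) (\<lambda>t. f t 0)"
    and \<Gamma>: "compact \<Gamma>" and D: "compact D" "D \<subseteq> \<Omega>" and C: "compact C" "C \<subseteq> D"
    and u: "continuous_on C u" "u ` C \<subseteq> \<Gamma>" and p: "continuous_on C p" and h: "continuous_on C h"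
    and below: "\<And>x. x \<in> C \<Longrightarrow> h x < 0 \<or> ennreal (h x) < f (x, u x) (p x)"
  obtains \<phi> where "continuous_on (D \<times> \<Gamma>) \<phi>"
    "\<And>t. t \<in> D \<times> \<Gamma> \<Longrightarrow> \<phi> t \<in> affine_minorants (f t)"
    "\<And>x. x \<in> C \<Longrightarrow> h x \<le> fst (\<phi> (x, u x)) \<bullet> p x + snd (\<phi> (x, u x))"
proof -
  let ?K = "\<lambda>t. affine_minorants (f t)"
  define G where "G = (\<lambda>x. (x, u x)) ` C"
  have G: "compact G"
    unfolding G_def using C u by (intro compact_continuous_image continuous_intros)
  have GD: "G \<subseteq> D \<times> \<Gamma>" using C u by (auto simp: G_def)
  define \<Phi> where "\<Phi> = (\<lambda>t. {v \<in> ?K t. t \<in> G \<longrightarrow> h (fst t) < (p (fst t), 1) \<bullet> v})"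
  have lhcK: "lhc_on (D \<times> \<Gamma>) ?K"
    using D(2) by (intro lhc_on_subset[OF lhc_on_affine_minorants[OF lsc cvx bdd]]) auto
  have lhc: "lhc_on (D \<times> \<Gamma>) \<Phi>"
    unfolding lhc_on_def
  proof (intro ballI allI impI)
    fix t v and e :: real
    assume t: "t \<in> D \<times> \<Gamma>" and v: "v \<in> \<Phi> t" and "e > 0"
    have vK: "v \<in> ?K t" using v by (simp add: \<Phi>_def)
    \<comment> \<open>The extra condition persists near \<open>(t, v)\<close>: it is absent near a
      point off the closed set \<open>G\<close>, and on \<open>G\<close> it is a strict inequality
      between continuous functions.\<close>
    obtain \<delta> where \<delta>: "\<delta> > 0"
      "\<And>s w. \<lbrakk>s \<in> G; dist s t < \<delta>; dist w v < \<delta>\<rbrakk> \<Longrightarrow> h (fst s) < (p (fst s), 1) \<bullet> w"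
    proof (cases "t \<in> G")
      case False
      then obtain \<delta> where "\<delta> > 0" "ball t \<delta> \<subseteq> - G"
        using G by (metis ComplI compact_imp_closed open_Compl openE)
      then show ?thesis by (intro that[of \<delta>]) (auto simp: dist_commute)
    next
      case True
      let ?q = "\<lambda>z. (p (fst z), 1::real) \<bullet> snd z - h (fst z)"
      have tC: "fst t \<in> C" using True by (auto simp: G_def)
      have "continuous_on (C \<times> UNIV) ?q"
        by (intro continuous_intros continuous_on_compose2[OF p] continuous_on_compose2[OF h]) auto
      moreover have "?q (fst t, v) > 0" using v True by (simp add: \<Phi>_def)
      ultimately obtain \<delta> where \<delta>: "\<delta> > 0"
          "\<And>z. \<lbrakk>z \<in> C \<times> UNIV; dist z (fst t, v) < \<delta>\<rbrakk> \<Longrightarrow> dist (?q z) (?q (fst t, v)) < ?q (fst t, v)"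
        using tC unfolding continuous_on_iff by (metis SigmaI UNIV_I)
      show ?thesis
      proof (rule that[of "\<delta> / 2"])
        fix s w assume s: "s \<in> G" "dist s t < \<delta> / 2" "dist w v < \<delta> / 2"
        have "dist (fst s, w) (fst t, v) \<le> dist (fst s) (fst t) + dist w v"
          unfolding dist_Pair_Pair by (rule sqrt_sum_squares_le_sum) auto
        also have "\<dots> < \<delta>" using s dist_fst_le[of s t] by simp
        finally have "dist (?q (fst s, w)) (?q (fst t, v)) < ?q (fst t, v)"
          using s(1) by (intro \<delta>(2)) (auto simp: G_def)
        then have "?q (fst s, w) > 0" unfolding dist_real_def by linarith
        then show "h (fst s) < (p (fst s), 1) \<bullet> w" by simp
      qed (use \<delta> in auto)
    qed
    have "min e \<delta> > 0" using \<open>e > 0\<close> \<delta> by simp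
    then obtain d where d: "d > 0" "\<And>s. \<lbrakk>s \<in> D \<times> \<Gamma>; dist s t < d\<rbrakk> \<Longrightarrow> \<exists>w\<in>?K s. dist w v < min e \<delta>"
      using lhcK t vK unfolding lhc_on_def by metis
    show "\<exists>d>0. \<forall>s\<in>D \<times> \<Gamma>. dist s t < d \<longrightarrow> (\<exists>w\<in>\<Phi> s. dist w v < e)"
    proof (intro exI[of _ "min d \<delta>"] conjI ballI impI)
      fix s assume s: "s \<in> D \<times> \<Gamma>" "dist s t < min d \<delta>"
      then obtain w where w: "w \<in> ?K s" "dist w v < min e \<delta>" using d(2)[of s] by auto
      then have "w \<in> \<Phi> s" using \<delta>(2)[of s w] s by (auto simp: \<Phi>_def)
      then show "\<exists>w\<in>\<Phi> s. dist w v < e" using w by auto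
    qed (use d \<delta> in auto)
  qed
  have "\<Phi> t \<noteq> {}" if t: "t \<in> D \<times> \<Gamma>" for t
  proof (cases "t \<in> G")
    case False
    then show ?thesis using zero_in_affine_minorants by (auto simp: \<Phi>_def)
  next
    case True
    then obtain x where x: "x \<in> C" "t = (x, u x)" by (auto simp: G_def)
    have tO: "t \<in> \<Omega> \<times> \<Gamma>" using t D by auto
    obtain v where "v \<in> ?K t" "h x < fst v \<bullet> p x + snd v"
      using affine_minorant_above[OF lsc_on_section[OF lsc tO] bspec[OF cvx tO]] below[OF x(1)] x(2) by metis
    then have "v \<in> \<Phi> t" using x by (simp add: \<Phi>_def inner_prod_def inner_commute)
    then show ?thesis by blast
  qed
  moreover have "convex (\<Phi> t)" for t
  proof -
    have "\<Phi> t = (if t \<in> G then ?K t \<inter> {v. (p (fst t), 1) \<bullet> v > h (fst t)} else ?K t)"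
      by (auto simp: \<Phi>_def)
    then show ?thesis
      by (simp add: convex_Int convex_affine_minorants convex_halfspace_gt del: inner_Pair)
  qed
  moreover have "compact (D \<times> \<Gamma>)" using D \<Gamma> by (intro compact_Times)
  ultimately obtain \<phi> where \<phi>: "continuous_on (D \<times> \<Gamma>) \<phi>" "\<And>t. t \<in> D \<times> \<Gamma> \<Longrightarrow> \<phi> t \<in> closure (\<Phi> t)"
    using michael_selection_compact[OF _ lhc] by blast
  show thesis
  proof (rule that[OF \<phi>(1)])
    fix t assume t: "t \<in> D \<times> \<Gamma>"
    have "closure (\<Phi> t) \<subseteq> ?K t"
      by (intro closure_minimal closed_affine_minorants) (auto simp: \<Phi>_def)
    then show "\<phi> t \<in> ?K t" using \<phi>(2)[OF t] by blast
  next
    fix x assume x: "x \<in> C"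
    then have xG: "(x, u x) \<in> G" by (simp add: G_def)
    \<comment> \<open>The closure only weakens the strict inequality.\<close>
    have "closure (\<Phi> (x, u x)) \<subseteq> {v. h x \<le> (p x, 1) \<bullet> v}"
      using xG by (intro closure_minimal closed_Collect_le continuous_intros) (auto simp: \<Phi>_def)
    then have "h x \<le> (p x, 1) \<bullet> \<phi> (x, u x)" using \<phi>(2)[of "(x, u x)"] xG GD by blast
    then show "h x \<le> fst (\<phi> (x, u x)) \<bullet> p x + snd (\<phi> (x, u x))"
      by (simp add: inner_prod_def inner_commute)
  qed
qed

section \<open>Functions vanishing at infinity and measurability\<close>

lemma Cc_onI:
  fixes U :: "'a::t2_space set"
  assumes "continuous_on U \<psi>" "compact T" "T \<subseteq> U" "\<And>t. t \<in> U - T \<Longrightarrow> \<psi> t = 0"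
  shows "\<psi> \<in> Cc_on U"
proof -
  have "support_on U \<psi> \<subseteq> T" using assms(4) by (auto simp: support_on_def)
  then have "closure (support_on U \<psi>) \<subseteq> T"
    using assms(2) by (intro closure_minimal compact_imp_closed)
  then have "U \<inter> closure (support_on U \<psi>) = T \<inter> closure (support_on U \<psi>)" using assms(3) by blast
  then show ?thesis using assms by (simp add: Cc_on_def compact_Int_closed)
qed

lemma Cc_on_imp_C0_on: "\<psi> \<in> Cc_on U \<Longrightarrow> \<psi> \<in> C0_on U"
  by (auto simp: C0_on_def intro!: bexI[of _ \<psi>])

text \<open>Applying \<open>T\<close> to the compactly supported approximants enlarges neither their
  support nor the error; this serves the two components of a field.\<close>

lemma C0_on_contraction:
  fixes U :: "'a::t2_space set"
  assumes \<phi>: "\<phi> \<in> C0_on U" and T: "continuous_on UNIV T" "T 0 = 0"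
    and contr: "\<And>x y. norm (T x - T y) \<le> norm (x - y)"
  shows "(\<lambda>t. T (\<phi> t)) \<in> C0_on U"
  unfolding C0_on_def
proof (intro CollectI allI impI)
  fix e :: real assume "e > 0"
  then obtain \<psi> where \<psi>: "\<psi> \<in> Cc_on U" "\<forall>t\<in>U. norm (\<phi> t - \<psi> t) \<le> e"
    using \<phi> unfolding C0_on_def by blast
  have "(\<lambda>t. T (\<psi> t)) \<in> Cc_on U"
  proof (rule Cc_onI)
    show "continuous_on U (\<lambda>t. T (\<psi> t))"
      using \<psi>(1) by (intro continuous_on_compose2[OF T(1)]) (auto simp: Cc_on_def)
    show "compact (U \<inter> closure (support_on U \<psi>))" using \<psi>(1) by (simp add: Cc_on_def)
    fix t assume "t \<in> U - U \<inter> closure (support_on U \<psi>)"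
    then have "\<psi> t = 0" using closure_subset[of "support_on U \<psi>"] by (auto simp: support_on_def)
    then show "T (\<psi> t) = 0" using T by simp
  qed auto
  moreover have "\<forall>t\<in>U. norm (T (\<phi> t) - T (\<psi> t)) \<le> e" using \<psi>(2) contr order_trans by blast
  ultimately show "\<exists>\<psi>\<in>Cc_on U. \<forall>t\<in>U. norm (T (\<phi> t) - \<psi> t) \<le> e"
    by (intro bexI[of _ "\<lambda>t. T (\<psi> t)"])
qed

lemma C0_on_fst: "\<phi> \<in> C0_on (U :: 'a::t2_space set) \<Longrightarrow> (\<lambda>t. fst (\<phi> t)) \<in> C0_on U"
  by (rule C0_on_contraction[of \<phi> U fst])
    (use norm_fst_le in \<open>auto simp: continuous_on_fst simp flip: fst_diff\<close>)

lemma C0_on_snd: "\<phi> \<in> C0_on (U :: 'a::t2_space set) \<Longrightarrow> (\<lambda>t. snd (\<phi> t)) \<in> C0_on U"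
  by (rule C0_on_contraction[of \<phi> U snd])
    (use norm_snd_le in \<open>auto simp: continuous_on_snd simp flip: snd_diff\<close>)

lemma C0_on_imp_continuous_on:
  assumes "\<phi> \<in> C0_on U"
  shows "continuous_on U \<phi>"
proof -
  have "\<forall>n::nat. \<exists>\<psi>. \<psi> \<in> Cc_on U \<and> (\<forall>t\<in>U. norm (\<phi> t - \<psi> t) \<le> inverse (Suc n))"
  proof
    fix n :: nat
    have "inverse (real (Suc n)) > 0" by simp
    then show "\<exists>\<psi>. \<psi> \<in> Cc_on U \<and> (\<forall>t\<in>U. norm (\<phi> t - \<psi> t) \<le> inverse (Suc n))"
      using assms unfolding C0_on_def by blast
  qed
  then obtain \<psi> where \<psi>: "\<And>n::nat. \<psi> n \<in> Cc_on U" "\<And>n t. t \<in> U \<Longrightarrow> norm (\<phi> t - \<psi> n t) \<le> inverse (Suc n)"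
    by metis
  have "uniform_limit U \<psi> \<phi> sequentially"
  proof (rule uniform_limitI)
    fix e :: real assume "e > 0"
    then have "\<forall>\<^sub>F n in sequentially. inverse (real (Suc n)) < e"
      using LIMSEQ_inverse_real_of_nat by (intro order_tendstoD) auto
    then show "\<forall>\<^sub>F n in sequentially. \<forall>t\<in>U. dist (\<psi> n t) (\<phi> t) < e"
      by eventually_elim (use \<psi>(2) in \<open>metis dist_norm norm_minus_commute le_less_trans\<close>)
  qed
  then show ?thesis
    using \<psi>(1) by (intro uniform_limit_theorem) (auto simp: Cc_on_def)
qed

text \<open>An approximant with error 1 is bounded on a compact set and zero elsewhere.\<close>

lemma C0_on_bounded:
  assumes "\<phi> \<in> C0_on U"
  obtains B where "\<And>t. t \<in> U \<Longrightarrow> norm (\<phi> t) \<le> B"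
proof -
  obtain \<psi> where \<psi>: "\<psi> \<in> Cc_on U" "\<And>t. t \<in> U \<Longrightarrow> norm (\<phi> t - \<psi> t) \<le> 1"
    using assms unfolding C0_on_def by (auto dest: spec[of _ 1])
  let ?T = "U \<inter> closure (support_on U \<psi>)"
  have "compact (\<psi> ` ?T)"
    using \<psi>(1) by (intro compact_continuous_image) (auto simp: Cc_on_def intro: continuous_on_subset)
  then obtain B where B: "B > 0" "\<And>t. t \<in> ?T \<Longrightarrow> norm (\<psi> t) \<le> B"
    using compact_imp_bounded[of "\<psi> ` ?T"] unfolding bounded_pos by blast
  show thesis
  proof
    fix t assume t: "t \<in> U"
    have "norm (\<psi> t) \<le> B"
    proof (cases "\<psi> t = 0")
      case False
      then have "t \<in> ?T" using t closure_subset[of "support_on U \<psi>"] by (auto simp: support_on_def)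
      then show ?thesis by (rule B)
    qed (use B in simp)
    then show "norm (\<phi> t) \<le> B + 1"
      using \<psi>(2)[OF t] norm_triangle_ineq[of "\<phi> t - \<psi> t" "\<psi> t"] by simp
  qed
qed

section \<open>Measurability and Lusin's theorem\<close>

lemma borel_measurable_lsc_on:
  fixes g :: "'a::topological_space \<Rightarrow> ennreal"
  assumes "lsc_on S g"
  shows "g \<in> borel_measurable (restrict_space borel S)"
proof (rule borel_measurableI_greater)
  fix y
  have "openin (top_of_set S) {x\<in>S. y < g x}"
  proof (subst openin_subopen, intro ballI)
    fix x assume x: "x \<in> {x\<in>S. y < g x}"
    then have "\<forall>\<^sub>F z in at x within S. y < g z" using assms by (auto simp: lsc_on_def)
    then obtain V where V: "open V" "x \<in> V" "\<And>z. \<lbrakk>z \<in> V; z \<noteq> x; z \<in> S\<rbrakk> \<Longrightarrow> y < g z"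
      unfolding eventually_at_topological by metis
    then show "\<exists>T. openin (top_of_set S) T \<and> x \<in> T \<and> T \<subseteq> {x\<in>S. y < g x}"
      using x by (intro exI[of _ "S \<inter> V"]) (auto intro: openin_open_Int)
  qed
  then obtain V where "open V" "{x\<in>S. y < g x} = S \<inter> V" by (auto simp: openin_open)
  then show "{x \<in> space (restrict_space borel S). y < g x} \<in> sets (restrict_space borel S)"
    by (auto simp: space_restrict_space sets_restrict_space)
qed

text \<open>For each basic open \<open>B n\<close>, its preimage and the rest of \<open>S\<close>
  are filled from inside by compact sets \<open>K n\<close> and \<open>L n\<close>. On the
  intersection \<open>C\<close> of all \<open>K n \<union> L n\<close>, the preimage of
  \<open>B n\<close> is the complement of the closed \<open>L n\<close>, so \<open>h\<close> is
  continuous there.\<close>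

lemma lusin:
  fixes h :: "'a::euclidean_space \<Rightarrow> 'b::second_countable_topology"
  assumes S: "S \<in> sets lebesgue" "bounded S"
    and h: "h \<in> borel_measurable (lebesgue_on S)" and "e > 0"
  obtains C where "compact C" "C \<subseteq> S" "emeasure lebesgue (S - C) \<le> ennreal e" "continuous_on C h"
proof -
  have inner: "\<exists>K. compact K \<and> K \<subseteq> A \<and> emeasure lebesgue (A - K) \<le> ennreal d"
    if "A \<in> sets lebesgue" "A \<subseteq> S" "d > 0" for A :: "'a set" and d
  proof -
    obtain K where K: "closed K" "K \<subseteq> A" "emeasure lebesgue (A - K) < ennreal d"
      by (rule sets_lebesgue_inner_closed[OF \<open>A \<in> sets lebesgue\<close> \<open>d > 0\<close>])
    moreover have "bounded K" using K that S(2) bounded_subset by blast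
    ultimately show ?thesis by (auto simp: compact_eq_bounded_closed intro: less_imp_le)
  qed
  obtain \<B> :: "'b set set" where \<B>: "countable \<B>" "topological_basis \<B>"
    using ex_countable_basis by blast
  \<comment> \<open>The empty set is added so that the enumerated family is nonempty.\<close>
  define B where "B = from_nat_into (insert {} \<B>)"
  have rB: "range B = insert {} \<B>"
    unfolding B_def using \<B> by (intro range_from_nat_into) auto
  have "open (B n)" for n
    using rB topological_basis_open[OF \<B>(2)] by (metis insertE open_empty rangeI)
  have B: "\<exists>n. x \<in> B n \<and> B n \<subseteq> V" if V: "open V" "x \<in> V" for x V
  proof -
    obtain W where "W \<in> \<B>" "x \<in> W" "W \<subseteq> V" using topological_basisE[OF \<B>(2) V] by blast
    moreover then obtain n where "W = B n" using rB by (metis imageE insertI2)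
    ultimately show ?thesis by blast
  qed
  define A where "A = (\<lambda>n. h -` B n \<inter> S)"
  have A: "A n \<in> sets lebesgue" "A n \<subseteq> S" for n
  proof -
    have "h -` B n \<inter> space (lebesgue_on S) \<in> sets (lebesgue_on S)"
      using \<open>open (B n)\<close> by (intro measurable_sets[OF h]) auto
    then show "A n \<in> sets lebesgue"
      using S by (simp add: A_def sets_restrict_space_iff)
  qed (simp add: A_def)
  \<comment> \<open>Both approximations at stage \<open>n\<close> together lose
    \<open>e * (1/2) ^ Suc n\<close>, which sums to \<open>e\<close>.\<close>
  let ?d = "\<lambda>n. e / 2 * (1/2) ^ Suc n"
  have d: "?d n > 0" for n using \<open>e > 0\<close> by simp
  have "\<forall>n. \<exists>K. compact K \<and> K \<subseteq> A n \<and> emeasure lebesgue (A n - K) \<le> ennreal (?d n)"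
    using inner[OF A d] by blast
  then obtain K where K: "\<And>n. compact (K n)" "\<And>n. K n \<subseteq> A n"
      "\<And>n. emeasure lebesgue (A n - K n) \<le> ennreal (?d n)"
    by metis
  have SA: "S - A n \<in> sets lebesgue" "S - A n \<subseteq> S" for n using A S by auto
  have "\<forall>n. \<exists>L. compact L \<and> L \<subseteq> S - A n \<and> emeasure lebesgue (S - A n - L) \<le> ennreal (?d n)"
    using inner[OF SA d] by blast
  then obtain L where L: "\<And>n. compact (L n)" "\<And>n. L n \<subseteq> S - A n"
      "\<And>n. emeasure lebesgue (S - A n - L n) \<le> ennreal (?d n)"
    by metis
  define C where "C = (\<Inter>n. K n \<union> L n)"
  define T where "T = (\<lambda>n. (A n - K n) \<union> (S - A n - L n))"
  have KL: "K n \<in> sets lebesgue" "L n \<in> sets lebesgue" for n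
    using K(1) L(1) by (auto intro!: lmeasurable_compact fmeasurableD)
  have Tm: "T n \<in> sets lebesgue" for n
    unfolding T_def using A S KL by auto
  have Td: "emeasure lebesgue (T n) \<le> ennreal (e * (1/2) ^ Suc n)" for n
  proof -
    have "emeasure lebesgue (T n) \<le> emeasure lebesgue (A n - K n) + emeasure lebesgue (S - A n - L n)"
      unfolding T_def using A SA KL by (intro emeasure_subadditive) auto
    also have "\<dots> \<le> ennreal (?d n) + ennreal (?d n)" by (intro add_mono K L)
    also have "\<dots> = ennreal (?d n + ?d n)"
      using d by (intro ennreal_plus[symmetric]) (auto intro: less_imp_le)
    finally show ?thesis by (simp add: field_simps)
  qed
  show thesis
  proof
    show "compact C"
      unfolding C_def using K L by (intro compact_Inter) (auto intro: compact_Un)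
    show "C \<subseteq> S" unfolding C_def using K(2) L(2) A(2) by blast
    have "emeasure lebesgue (S - C) \<le> emeasure lebesgue (\<Union>n. T n)"
      using Tm by (intro emeasure_mono) (auto simp: C_def T_def)
    also have "\<dots> \<le> (\<Sum>n. emeasure lebesgue (T n))"
      using Tm by (intro emeasure_subadditive_countably) auto
    also have "\<dots> \<le> (\<Sum>n. ennreal (e * (1/2) ^ Suc n))"
      using Td by (intro suminf_le) auto
    also have "\<dots> = ennreal e"
      using sums_mult[OF power_half_series, of e] \<open>e > 0\<close> by (intro suminf_ennreal_eq) auto
    finally show "emeasure lebesgue (S - C) \<le> ennreal e" .
    show "continuous_on C h"
      unfolding continuous_on_topological
    proof (intro ballI allI impI)
      fix x V assume x: "x \<in> C" and V: "open V" "h x \<in> V"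
      obtain n where n: "h x \<in> B n" "B n \<subseteq> V" using B[OF V] by blast
      have "x \<in> S" using x \<open>C \<subseteq> S\<close> by blast
      show "\<exists>W. open W \<and> x \<in> W \<and> (\<forall>y\<in>C. y \<in> W \<longrightarrow> h y \<in> V)"
      proof (intro exI[of _ "- L n"] conjI ballI impI)
        show "open (- L n)" using L(1) by (simp add: compact_imp_closed open_Compl)
        show "x \<in> - L n" using n L(2) \<open>x \<in> S\<close> by (auto simp: A_def)
        fix y assume "y \<in> C" "y \<in> - L n"
        then have "y \<in> K n" by (auto simp: C_def)
        then show "h y \<in> V" using K(2) n by (auto simp: A_def)
      qed
    qed
  qed
qed

section \<open>The functional on graph measures\<close>

lemma borel_measurable_graph:
  fixes u :: "'d::euclidean_space \<Rightarrow> 's::euclidean_space"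
  assumes "\<Omega> \<in> sets lebesgue" "u \<in> borel_measurable (lebesgue_on \<Omega>)"
  shows "(\<lambda>x. (x, u x)) \<in> borel_measurable (lebesgue_on \<Omega>)"
  using assms(1)
  by (intro borel_measurable_Pair[OF _ assms(2)] continuous_imp_measurable_on_sets_lebesgue continuous_on_id)

lemma borel_measurable_graph_comp:
  fixes u :: "'d::euclidean_space \<Rightarrow> 's::euclidean_space" and \<phi> :: "'d \<times> 's \<Rightarrow> 'b::topological_space"
  assumes "\<Omega> \<in> sets lebesgue" "u \<in> borel_measurable (lebesgue_on \<Omega>)" "u \<in> \<Omega> \<rightarrow> \<Gamma>"
    and "continuous_on (\<Omega> \<times> \<Gamma>) \<phi>"
  shows "(\<lambda>x. \<phi> (x, u x)) \<in> borel_measurable (lebesgue_on \<Omega>)"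
proof (rule measurable_compose[where g = \<phi> and N = "restrict_space borel (\<Omega> \<times> \<Gamma>)"])
  show "(\<lambda>x. (x, u x)) \<in> lebesgue_on \<Omega> \<rightarrow>\<^sub>M restrict_space borel (\<Omega> \<times> \<Gamma>)"
    using assms by (intro measurable_restrict_space2 borel_measurable_graph) (auto simp: space_restrict_space)
  show "\<phi> \<in> borel_measurable (restrict_space borel (\<Omega> \<times> \<Gamma>))"
    using assms by (intro borel_measurable_continuous_on_restrict)
qed

lemma borel_measurable_lsc_integrand:
  fixes f :: "'d::euclidean_space \<times> 's::euclidean_space \<Rightarrow> 'm::euclidean_space \<Rightarrow> ennreal"
  assumes "lsc_on ((\<Omega> \<times> \<Gamma>) \<times> UNIV) (\<lambda>(t, q). f t q)"
    and "\<Omega> \<in> sets lebesgue" "u \<in> borel_measurable (lebesgue_on \<Omega>)" "u \<in> \<Omega> \<rightarrow> \<Gamma>"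
    and "p \<in> borel_measurable (lebesgue_on \<Omega>)"
  shows "(\<lambda>x. f (x, u x) (p x)) \<in> borel_measurable (lebesgue_on \<Omega>)"
proof -
  have "(\<lambda>x. ((x, u x), p x)) \<in> lebesgue_on \<Omega> \<rightarrow>\<^sub>M restrict_space borel ((\<Omega> \<times> \<Gamma>) \<times> UNIV)"
    using assms
    by (intro measurable_restrict_space2 borel_measurable_Pair[OF borel_measurable_graph])
      (auto simp: space_restrict_space)
  from measurable_compose[OF this borel_measurable_lsc_on[OF assms(1)]] show ?thesis by simp
qed

text \<open>\<open>\<integral>\<langle>\<phi>\<^sup>\<xi>, dE\<rangle> + \<integral>\<phi>\<^sup>\<lambda> d\<mu>\<close> for \<open>E = p \<delta>\<^sub>u\<close> and \<open>\<mu> = \<delta>\<^sub>u\<close>\<close>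

definition graph_pairing ::
    "'d::euclidean_space set \<Rightarrow> ('d \<Rightarrow> 's) \<Rightarrow> ('d \<Rightarrow> 'm::euclidean_space) \<Rightarrow> ('d \<times> 's \<Rightarrow> 'm \<times> real) \<Rightarrow> real" where
  "graph_pairing \<Omega> u p \<phi> = (LINT x|lebesgue_on \<Omega>. fst (\<phi> (x, u x)) \<bullet> p x + snd (\<phi> (x, u x)))"

text \<open>\<open>is_graph_delta\<close> has no integrability clause; here integrability comes from
  a bounded field on a domain of finite measure.\<close>

lemma integrable_graph_snd:
  fixes \<Omega> :: "'d::euclidean_space set" and \<Gamma> :: "'s::euclidean_space set"
    and \<phi> :: "'d \<times> 's \<Rightarrow> 'm::euclidean_space \<times> real"
  assumes \<Omega>: "\<Omega> \<in> lmeasurable" and u: "u \<in> borel_measurable (lebesgue_on \<Omega>)" "u \<in> \<Omega> \<rightarrow> \<Gamma>"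
    and \<phi>: "\<phi> \<in> C0_on (\<Omega> \<times> \<Gamma>)"
  shows "integrable (lebesgue_on \<Omega>) (\<lambda>x. snd (\<phi> (x, u x)))"
proof -
  interpret finite_measure "lebesgue_on \<Omega>"
    using \<Omega> by (rule finite_measure_lebesgue_on)
  note \<psi> = C0_on_snd[OF \<phi>]
  obtain B where "\<And>t. t \<in> \<Omega> \<times> \<Gamma> \<Longrightarrow> norm (snd (\<phi> t)) \<le> B" using C0_on_bounded[OF \<psi>] by blast
  then show ?thesis
    using \<Omega> u C0_on_imp_continuous_on[OF \<psi>]
    by (intro integrable_const_bound[where B = B] AE_I2 borel_measurable_graph_comp)
      (auto simp: space_restrict_space)
qed

text \<open>Both components of an admissible field are test functions, so the hypotheses on
  \<open>E\<close> and \<open>\<mu>\<close> apply to them separately; integrability lets the two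
  integrals merge.\<close>

lemma BB_functional_graph:
  fixes \<Omega> :: "'d::euclidean_space set" and \<Gamma> :: "'s::euclidean_space set"
    and f :: "'d \<times> 's \<Rightarrow> 'm::euclidean_space \<Rightarrow> ennreal"
  assumes \<Omega>: "\<Omega> \<in> lmeasurable" and u: "u \<in> borel_measurable (lebesgue_on \<Omega>)" "u \<in> \<Omega> \<rightarrow> \<Gamma>"
    and \<mu>: "is_graph_delta \<Omega> \<Gamma> u \<mu>" and E: "is_graph_density \<Omega> \<Gamma> u p E"
  shows "BB_functional (\<Omega> \<times> \<Gamma>) f (\<lambda>A. (E A, \<mu> A))
           = (SUP \<phi>\<in>BB_admissible (\<Omega> \<times> \<Gamma>) f. ereal (graph_pairing \<Omega> u p \<phi>))"
  unfolding BB_functional_def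
proof (intro SUP_cong refl arg_cong[where f = ereal])
  fix \<phi> assume "\<phi> \<in> BB_admissible (\<Omega> \<times> \<Gamma>) f"
  then have \<phi>: "\<phi> \<in> C0_on (\<Omega> \<times> \<Gamma>)" by (simp add: BB_admissible_def)
  have "integrable (lebesgue_on \<Omega>) (\<lambda>x. fst (\<phi> (x, u x)) \<bullet> p x)"
    and 1: "vector_integral (\<Omega> \<times> \<Gamma>) E (\<lambda>t. fst (\<phi> t)) = (LINT x|lebesgue_on \<Omega>. fst (\<phi> (x, u x)) \<bullet> p x)"
    using bspec[OF E[unfolded is_graph_density_def] C0_on_fst[OF \<phi>]] by simp_all
  moreover have "vector_integral (\<Omega> \<times> \<Gamma>) \<mu> (\<lambda>t. snd (\<phi> t)) = (LINT x|lebesgue_on \<Omega>. snd (\<phi> (x, u x)))"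
    using bspec[OF \<mu>[unfolded is_graph_delta_def] C0_on_snd[OF \<phi>]] by simp
  ultimately show "vector_integral (\<Omega> \<times> \<Gamma>) (\<lambda>A. fst (E A, \<mu> A)) (\<lambda>t. fst (\<phi> t))
      + vector_integral (\<Omega> \<times> \<Gamma>) (\<lambda>A. snd (E A, \<mu> A)) (\<lambda>t. snd (\<phi> t)) = graph_pairing \<Omega> u p \<phi>"
    unfolding graph_pairing_def
    by (subst Bochner_Integration.integral_add) (auto intro: integrable_graph_snd[OF \<Omega> u \<phi>])
qed

section \<open>The upper bound\<close>

lemma integral_le_nn_integral:
  fixes g :: "'a \<Rightarrow> real"
  assumes "integrable M g" "\<And>x. x \<in> space M \<Longrightarrow> ennreal (g x) \<le> F x"
  shows "ereal (integral\<^sup>L M g) \<le> enn2ereal (\<integral>\<^sup>+x. F x \<partial>M)"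
proof -
  \<comment> \<open>\<open>F\<close> dominates only \<open>ennreal (g x)\<close>, the positive part
    of \<open>g\<close>, so the comparison passes through \<open>max 0 (g x)\<close>.\<close>
  have int: "integrable M (\<lambda>x. max 0 (g x))" using assms(1) by auto
  have "integral\<^sup>L M g \<le> (LINT x|M. max 0 (g x))"
    using assms(1) int by (intro integral_mono) auto
  also have "ereal \<dots> = enn2ereal (ennreal (LINT x|M. max 0 (g x)))"
    by (simp add: enn2ereal_ennreal)
  also have "ennreal (LINT x|M. max 0 (g x)) = (\<integral>\<^sup>+x. ennreal (max 0 (g x)) \<partial>M)"
    using int by (intro nn_integral_eq_integral[symmetric]) auto
  also have "\<dots> \<le> (\<integral>\<^sup>+x. F x \<partial>M)"
    using assms(2) by (intro nn_integral_mono) (auto simp: max_def)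
  finally show ?thesis by (simp add: less_eq_ennreal.rep_eq)
qed

lemma graph_pairing_le:
  fixes \<Omega> :: "'d::euclidean_space set" and \<Gamma> :: "'s::euclidean_space set"
    and f :: "'d \<times> 's \<Rightarrow> 'm::euclidean_space \<Rightarrow> ennreal"
  assumes \<Omega>: "\<Omega> \<in> lmeasurable" and u: "u \<in> borel_measurable (lebesgue_on \<Omega>)" "u \<in> \<Omega> \<rightarrow> \<Gamma>"
    and E: "is_graph_density \<Omega> \<Gamma> u p E"
    and adm: "\<phi> \<in> BB_admissible (\<Omega> \<times> \<Gamma>) f"
  shows "ereal (graph_pairing \<Omega> u p \<phi>) \<le> enn2ereal (\<integral>\<^sup>+x. f (x, u x) (p x) \<partial>lebesgue_on \<Omega>)"
  unfolding graph_pairing_def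
proof (rule integral_le_nn_integral)
  have \<phi>: "\<phi> \<in> C0_on (\<Omega> \<times> \<Gamma>)" using adm by (simp add: BB_admissible_def)
  have "integrable (lebesgue_on \<Omega>) (\<lambda>x. fst (\<phi> (x, u x)) \<bullet> p x)"
    using bspec[OF E[unfolded is_graph_density_def] C0_on_fst[OF \<phi>]] by simp
  then show "integrable (lebesgue_on \<Omega>) (\<lambda>x. fst (\<phi> (x, u x)) \<bullet> p x + snd (\<phi> (x, u x)))"
    using integrable_graph_snd[OF \<Omega> u \<phi>] by (rule Bochner_Integration.integrable_add)
  fix x assume "x \<in> space (lebesgue_on \<Omega>)"
  then have "(x, u x) \<in> \<Omega> \<times> \<Gamma>" using u by (auto simp: space_restrict_space)
  then have "\<phi> (x, u x) \<in> affine_minorants (f (x, u x))"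
    using adm conj_snd_le_iff[of f "(x, u x)" "fst (\<phi> (x, u x))" "snd (\<phi> (x, u x))"]
    by (auto simp: BB_admissible_def)
  then show "ennreal (fst (\<phi> (x, u x)) \<bullet> p x + snd (\<phi> (x, u x))) \<le> f (x, u x) (p x)"
    by (rule affine_minorantsD)
qed

section \<open>The lower bound: cutoffs and Lusin approximation\<close>

text \<open>A near-optimal selection on the compact set \<open>C\<close> may be very negative off \<open>C\<close>; this is repaired
  by multiplying it with cutoffs that shrink to \<open>C\<close>, which keeps it admissible as \<open>f \<ge> 0\<close>.\<close>

lemma admissible_near_optimal_on_compact:
  fixes \<Omega> :: "'d::euclidean_space set" and \<Gamma> :: "'s::euclidean_space set"
    and f :: "'d \<times> 's \<Rightarrow> 'm::euclidean_space \<Rightarrow> ennreal"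
  assumes \<Omega>: "open \<Omega>" "bounded \<Omega>" and \<Gamma>: "compact \<Gamma>"
    and lsc: "lsc_on ((\<Omega> \<times> \<Gamma>) \<times> UNIV) (\<lambda>(t, q). f t q)"
    and cvx: "\<forall>t\<in>\<Omega> \<times> \<Gamma>. ennreal_convex (f t)"
    and bdd: "locally_bounded_on (\<Omega> \<times> \<Gamma>) (\<lambda>t. f t 0)"
    and u: "u \<in> borel_measurable (lebesgue_on \<Omega>)" "u \<in> \<Omega> \<rightarrow> \<Gamma>"
    and p: "p \<in> borel_measurable (lebesgue_on \<Omega>)"
    and E: "is_graph_density \<Omega> \<Gamma> u p E"
    and C: "compact C" "C \<subseteq> \<Omega>" "C \<noteq> {}"
    and cont: "continuous_on C u" "continuous_on C p" "continuous_on C h"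
    and below: "\<And>x. x \<in> C \<Longrightarrow> h x < 0 \<or> ennreal (h x) < f (x, u x) (p x)"
    and h: "integrable (lebesgue_on \<Omega>) (\<lambda>x. indicator C x * h x)"
    and r: "r < (LINT x|lebesgue_on \<Omega>. indicator C x * h x)"
  obtains \<phi> where "\<phi> \<in> BB_admissible (\<Omega> \<times> \<Gamma>) f" "r < graph_pairing \<Omega> u p \<phi>"
proof -
  let ?M = "lebesgue_on \<Omega>"
  have \<Omega>m: "\<Omega> \<in> lmeasurable" using \<Omega> by (simp add: lmeasurable_open)
  then have \<Omega>s: "\<Omega> \<in> sets lebesgue" by (rule fmeasurableD)
  \<comment> \<open>A compact neighbourhood \<open>D\<close> of \<open>C\<close> inside
    \<open>\<Omega>\<close> leaves room for the cutoffs.\<close>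
  obtain \<rho> where \<rho>: "\<rho> > 0" "(\<Union>x\<in>C. cball x \<rho>) \<subseteq> \<Omega>"
    using compact_subset_open_imp_cball_epsilon_subset[OF C(1) \<Omega>(1) C(2)] by blast
  define D where "D = (\<Union>x\<in>C. cball x \<rho>)"
  have D: "compact D" "D \<subseteq> \<Omega>" "C \<subseteq> D"
    using compact_minkowski_sum_cball[OF C(1)] \<rho> by (auto simp: D_def)
  have uC: "u ` C \<subseteq> \<Gamma>" using u(2) C(2) by auto
  obtain \<phi> where \<phi>: "continuous_on (D \<times> \<Gamma>) \<phi>"
    "\<And>t. t \<in> D \<times> \<Gamma> \<Longrightarrow> \<phi> t \<in> affine_minorants (f t)"
    "\<And>x. x \<in> C \<Longrightarrow> h x \<le> fst (\<phi> (x, u x)) \<bullet> p x + snd (\<phi> (x, u x))"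
    using near_optimal_selection[OF lsc cvx bdd \<Gamma> D(1,2) C(1) D(3) cont(1) uC cont(2,3) below] by blast
  have T: "compact (D \<times> \<Gamma>)" using D \<Gamma> by (intro compact_Times)
  have "bounded (\<phi> ` (D \<times> \<Gamma>))" using T \<phi>(1) compact_continuous_image compact_imp_bounded by blast
  then obtain B where B: "B > 0" "\<And>t. t \<in> D \<times> \<Gamma> \<Longrightarrow> norm (\<phi> t) \<le> B"
    unfolding bounded_pos by blast
  have "closedin (top_of_set UNIV) (D \<times> \<Gamma>)" using T by (simp add: compact_imp_closed)
  \<comment> \<open>Tietze extends the selection to the whole space; at points of
    \<open>\<Omega> \<times> \<Gamma>\<close> off \<open>D \<times> \<Gamma>\<close> the cutoff will
    remove it.\<close>
  then obtain g where g: "continuous_on UNIV g" "\<And>t. t \<in> D \<times> \<Gamma> \<Longrightarrow> g t = \<phi> t"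
    using Tietze[OF \<phi>(1), of UNIV B] B by (metis less_imp_le)
  \<comment> \<open>\<open>\<eta> n\<close> is 1 on \<open>C\<close> and vanishes from distance
    \<open>\<rho> / Suc n\<close> on. Already \<open>\<eta> 0\<close> vanishes off \<open>D\<close>,
    and the sequence decreases to the indicator of \<open>C\<close>.\<close>
  define \<eta> where "\<eta> = (\<lambda>n x. max 0 (1 - real (Suc n) / \<rho> * infdist x C))"
  define \<Psi> where "\<Psi> = (\<lambda>n (t :: 'd \<times> 's). \<eta> n (fst t) *\<^sub>R g t)"
  have \<eta>0: "\<eta> n x \<ge> 0" for n x by (simp add: \<eta>_def)
  have \<eta>1: "\<eta> n x \<le> 1" for n x using \<rho>(1) by (simp add: \<eta>_def infdist_nonneg)
  have \<eta>anti: "\<eta> n x \<le> \<eta> 0 x" for n x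
  proof -
    have "real (Suc 0) / \<rho> * infdist x C \<le> real (Suc n) / \<rho> * infdist x C"
      using \<rho>(1) by (intro mult_right_mono divide_right_mono) (auto simp: infdist_nonneg)
    then show ?thesis by (simp add: \<eta>_def)
  qed
  have \<eta>D: "\<eta> n x = 0" if "x \<notin> D" for n x
  proof -
    obtain c where c: "c \<in> C" "infdist x C = dist x c"
      using infdist_attains_inf[OF compact_imp_closed[OF C(1)] C(3)] by blast
    have "\<rho> < dist x c" using that c by (force simp: D_def dist_commute)
    then have "1 / \<rho> * infdist x C \<ge> 1" using c \<rho>(1) by (simp add: field_simps)
    then have "\<eta> 0 x = 0" by (simp add: \<eta>_def)
    then show ?thesis using \<eta>anti[of n x] \<eta>0[of n x] by simp
  qed
  have \<eta>lim: "(\<lambda>n. \<eta> n x) \<longlonglongrightarrow> indicator C x" for x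
  proof (cases "x \<in> C")
    case True
    then show ?thesis by (simp add: \<eta>_def)
  next
    case False
    then have "infdist x C > 0"
      using C in_closed_iff_infdist_zero[of C x] infdist_nonneg[of x C] by (auto simp: compact_imp_closed less_le)
    then have pos: "infdist x C / \<rho> > 0" using \<rho>(1) by simp
    obtain N where N: "1 < real N * (infdist x C / \<rho>)"
      using reals_Archimedean3[OF pos] by blast
    have "\<eta> n x = 0" if "n \<ge> N" for n
    proof -
      have "real N * (infdist x C / \<rho>) \<le> real (Suc n) * (infdist x C / \<rho>)"
        using that pos by (intro mult_right_mono) auto
      then show ?thesis using N by (simp add: \<eta>_def)
    qed
    then have "\<forall>\<^sub>F n in sequentially. \<eta> n x = 0"
      unfolding eventually_sequentially by blast
    then show ?thesis using False by (simp add: tendsto_eventually)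
  qed
  have \<eta>c: "continuous_on UNIV (\<eta> n)" for n
    unfolding \<eta>_def by (intro continuous_intros)
  have "continuous_on UNIV (\<lambda>t :: 'd \<times> 's. \<eta> n (fst t))" for n
    by (rule continuous_on_compose2[OF \<eta>c continuous_on_fst[OF continuous_on_id]]) simp
  then have "continuous_on UNIV (\<Psi> n)" for n
    unfolding \<Psi>_def by (intro continuous_on_scaleR g(1))
  then have "continuous_on (\<Omega> \<times> \<Gamma>) (\<Psi> n)" for n
    by (rule continuous_on_subset) simp
  moreover have "\<Psi> n t = 0" if "t \<in> \<Omega> \<times> \<Gamma> - D \<times> \<Gamma>" for n t
  proof -
    have "fst t \<notin> D" using that by auto
    then show ?thesis using \<eta>D by (simp add: \<Psi>_def)
  qed
  ultimately have "\<Psi> n \<in> Cc_on (\<Omega> \<times> \<Gamma>)" for n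
    using D(2) by (intro Cc_onI[where T = "D \<times> \<Gamma>"] T) auto
  then have C0: "\<Psi> n \<in> C0_on (\<Omega> \<times> \<Gamma>)" for n
    by (rule Cc_on_imp_C0_on)
  have adm: "\<Psi> n \<in> BB_admissible (\<Omega> \<times> \<Gamma>) f" for n
  proof -
    have "\<Psi> n t \<in> affine_minorants (f t)" if t: "t \<in> \<Omega> \<times> \<Gamma>" for t
    proof (cases "fst t \<in> D")
      case True
      then have "t \<in> D \<times> \<Gamma>" using t by auto
      then have "g t \<in> affine_minorants (f t)" using g(2) \<phi>(2) by simp
      \<comment> \<open>Scaling by \<open>\<eta> n\<close> is a convex combination with the minorant
        0.\<close>
      then have "\<eta> n (fst t) *\<^sub>R g t + (1 - \<eta> n (fst t)) *\<^sub>R 0 \<in> affine_minorants (f t)"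
        using \<eta>0 \<eta>1 zero_in_affine_minorants by (intro convexD[OF convex_affine_minorants]) auto
      then show ?thesis by (simp add: \<Psi>_def)
    next
      case False
      then show ?thesis using \<eta>D zero_in_affine_minorants by (simp add: \<Psi>_def)
    qed
    then show ?thesis
      using C0 by (auto simp: BB_admissible_def conj_snd_le_iff)
  qed
  define \<psi> where "\<psi> = (\<lambda>x. fst (g (x, u x)) \<bullet> p x + snd (g (x, u x)))"
  have pairing: "graph_pairing \<Omega> u p (\<Psi> n) = (LINT x|?M. \<eta> n x * \<psi> x)" for n
    unfolding graph_pairing_def \<Psi>_def \<psi>_def by (simp add: algebra_simps)
  \<comment> \<open>\<open>p\<close> is only assumed measurable; integrability comes from
    \<open>is_graph_density\<close> tested with \<open>\<Psi> n\<close>. The case of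
    \<open>\<eta> 0\<close> then provides the dominating function.\<close>
  have int: "integrable ?M (\<lambda>x. \<eta> n x * \<psi> x)" for n
  proof -
    have "integrable ?M (\<lambda>x. fst (\<Psi> n (x, u x)) \<bullet> p x)"
      using bspec[OF E[unfolded is_graph_density_def] C0_on_fst[OF C0]] by simp
    from Bochner_Integration.integrable_add[OF this integrable_graph_snd[OF \<Omega>m u C0]]
    show ?thesis by (simp add: \<Psi>_def \<psi>_def algebra_simps)
  qed
  have gm: "(\<lambda>x. g (x, u x)) \<in> borel_measurable ?M"
    using u \<Omega>s continuous_on_subset[OF g(1)] by (intro borel_measurable_graph_comp) auto
  have CM: "C \<in> sets ?M"
    using C(2) \<Omega>s fmeasurableD[OF lmeasurable_compact[OF C(1)]] by (simp add: sets_restrict_space_iff)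
  have "(\<lambda>x. fst (g (x, u x))) \<in> borel_measurable ?M" "(\<lambda>x. snd (g (x, u x))) \<in> borel_measurable ?M"
    by (intro measurable_compose[OF gm] borel_measurable_continuous_onI continuous_intros)+
  then have "\<psi> \<in> borel_measurable ?M"
    unfolding \<psi>_def by (intro borel_measurable_add borel_measurable_inner p)
  then have \<psi>m: "(\<lambda>x. indicator C x * \<psi> x) \<in> borel_measurable ?M"
    using CM by (intro borel_measurable_times borel_measurable_indicator)
  have dom: "AE x in ?M. norm (\<eta> n x * \<psi> x) \<le> norm (\<eta> 0 x * \<psi> x)" for n
    using \<eta>anti \<eta>0 by (intro AE_I2) (auto simp: abs_mult intro!: mult_right_mono)
  have lim: "AE x in ?M. (\<lambda>n. \<eta> n x * \<psi> x) \<longlonglongrightarrow> indicator C x * \<psi> x"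
    by (intro AE_I2 tendsto_mult \<eta>lim tendsto_const)
  have i0: "integrable ?M (\<lambda>x. norm (\<eta> 0 x * \<psi> x))" by (intro integrable_norm int)
  have m: "(\<lambda>x. \<eta> n x * \<psi> x) \<in> borel_measurable ?M" for n using int by blast
  have "(\<lambda>n. LINT x|?M. \<eta> n x * \<psi> x) \<longlonglongrightarrow> (LINT x|?M. indicator C x * \<psi> x)"
    by (rule integral_dominated_convergence[OF \<psi>m m i0 lim dom])
  moreover have "integrable ?M (\<lambda>x. indicator C x * \<psi> x)"
    by (rule integrable_dominated_convergence[OF \<psi>m m i0 lim dom])
  \<comment> \<open>On \<open>C\<close> the selection lies above \<open>h\<close>; off
    \<open>C\<close> both integrands vanish.\<close>
  then have "(LINT x|?M. indicator C x * h x) \<le> (LINT x|?M. indicator C x * \<psi> x)"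
    using h \<phi>(3) g(2) uC D(3)
    by (intro integral_mono) (auto simp: \<psi>_def indicator_def image_subset_iff subset_iff)
  then have "r < (LINT x|?M. indicator C x * \<psi> x)" using r by simp
  ultimately have "\<forall>\<^sub>F n in sequentially. r < (LINT x|?M. \<eta> n x * \<psi> x)"
    by (rule order_tendstoD)
  then obtain n where "r < (LINT x|?M. \<eta> n x * \<psi> x)"
    unfolding eventually_sequentially by blast
  then show thesis using that[OF adm] pairing by simp
qed

text \<open>Lusin sets are taken with errors \<open>(1/2)^k\<close>: by Borel-Cantelli almost every
  point lies in all but finitely many \<open>C k\<close>, so dominated convergence recovers the
  integral of \<open>F\<close>.\<close>

lemma lusin_integral:
  fixes h :: "'a::euclidean_space \<Rightarrow> 'b::second_countable_topology" and F :: "'a \<Rightarrow> real"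
  assumes S: "S \<in> sets lebesgue" "bounded S" and h: "h \<in> borel_measurable (lebesgue_on S)"
    and F: "integrable (lebesgue_on S) F" and "e > 0"
  obtains C where "compact C" "C \<subseteq> S" "continuous_on C h"
    "integrable (lebesgue_on S) (\<lambda>x. indicator C x * F x)"
    "(LINT x|lebesgue_on S. F x) - e < (LINT x|lebesgue_on S. indicator C x * F x)"
proof -
  let ?M = "lebesgue_on S"
  have "\<forall>k::nat. \<exists>C. compact C \<and> C \<subseteq> S \<and> emeasure lebesgue (S - C) \<le> ennreal ((1/2)^k) \<and> continuous_on C h"
  proof
    fix k :: nat
    have "(1/2::real)^k > 0" by simp
    from lusin[OF S h this]
    show "\<exists>C. compact C \<and> C \<subseteq> S \<and> emeasure lebesgue (S - C) \<le> ennreal ((1/2)^k) \<and> continuous_on C h"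
      by blast
  qed
  then obtain C where C: "\<And>k::nat. compact (C k)" "\<And>k. C k \<subseteq> S"
      "\<And>k. emeasure lebesgue (S - C k) \<le> ennreal ((1/2)^k)" "\<And>k. continuous_on (C k) h"
    by metis
  have CM: "C k \<in> sets ?M" for k
    using C(2) S(1) fmeasurableD[OF lmeasurable_compact[OF C(1)]] by (simp add: sets_restrict_space_iff)
  have AM: "S - C k \<in> sets ?M" for k
    using sets.compl_sets[OF CM[of k]] by (simp add: space_restrict_space)
  have em: "emeasure ?M (S - C k) \<le> ennreal ((1/2)^k)" for k
    using C(3)[of k] S by (simp add: emeasure_restrict_space)
  then have me: "measure ?M (S - C k) \<le> (1/2)^k" for k
    unfolding measure_def by (intro enn2real_leI) auto
  have "summable (\<lambda>k. measure ?M (S - C k))"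
    using me by (intro summable_comparison_test[OF _ summable_geometric[of "1/2::real"]]) auto
  then have "AE x in ?M. \<forall>\<^sub>F k in sequentially. x \<in> space ?M - (S - C k)"
    using AM le_less_trans[OF em ennreal_less_top] by (intro borel_cantelli_AE1) auto
  then have "AE x in ?M. (\<lambda>k. indicator (C k) x * F x) \<longlonglongrightarrow> F x"
  proof eventually_elim
    case (elim x)
    then have "\<forall>\<^sub>F k in sequentially. indicator (C k) x * F x = F x"
      by eventually_elim (auto simp: space_restrict_space)
    then show ?case by (rule tendsto_eventually)
  qed
  moreover have "AE x in ?M. norm (indicator (C k) x * F x) \<le> norm (F x)" for k
    by (intro AE_I2) (auto simp: indicator_def)
  moreover have m: "(\<lambda>x. indicator (C k) x * F x) \<in> borel_measurable ?M" for k
    using F CM by (intro borel_measurable_times borel_measurable_indicator) auto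
  ultimately have "(\<lambda>k. LINT x|?M. indicator (C k) x * F x) \<longlonglongrightarrow> (LINT x|?M. F x)"
    using F by (intro integral_dominated_convergence[where w = "\<lambda>x. norm (F x)"]) auto
  then have "\<forall>\<^sub>F k in sequentially. (LINT x|?M. F x) - e < (LINT x|?M. indicator (C k) x * F x)"
    using \<open>e > 0\<close> by (intro order_tendstoD) auto
  then obtain k where k: "(LINT x|?M. F x) - e < (LINT x|?M. indicator (C k) x * F x)"
    unfolding eventually_sequentially by blast
  show thesis
  proof (rule that[OF C(1,2,4) _ k])
    show "integrable ?M (\<lambda>x. indicator (C k) x * F x)"
      using F m by (rule Bochner_Integration.integrable_bound) (auto simp: indicator_def)
  qed
qed

text \<open>Lowering the integrand by a constant \<open>\<kappa>\<close> leaves strict room for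
  affine minorants on a Lusin set \<open>C\<close>. Half of \<open>e\<close> pays for the points off
  \<open>C\<close>, half for \<open>\<kappa>\<close>.\<close>

lemma admissible_near_optimal:
  fixes \<Omega> :: "'d::euclidean_space set" and \<Gamma> :: "'s::euclidean_space set"
    and f :: "'d \<times> 's \<Rightarrow> 'm::euclidean_space \<Rightarrow> ennreal"
  assumes \<Omega>: "open \<Omega>" "bounded \<Omega>" and \<Gamma>: "compact \<Gamma>"
    and lsc: "lsc_on ((\<Omega> \<times> \<Gamma>) \<times> UNIV) (\<lambda>(t, q). f t q)"
    and cvx: "\<forall>t\<in>\<Omega> \<times> \<Gamma>. ennreal_convex (f t)"
    and bdd: "locally_bounded_on (\<Omega> \<times> \<Gamma>) (\<lambda>t. f t 0)"
    and u: "u \<in> borel_measurable (lebesgue_on \<Omega>)" "u \<in> \<Omega> \<rightarrow> \<Gamma>"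
    and p: "p \<in> borel_measurable (lebesgue_on \<Omega>)"
    and fin: "(\<integral>\<^sup>+x. f (x, u x) (p x) \<partial>lebesgue_on \<Omega>) < \<infinity>"
    and E: "is_graph_density \<Omega> \<Gamma> u p E" and "e > 0"
  obtains \<phi> where "\<phi> \<in> BB_admissible (\<Omega> \<times> \<Gamma>) f"
    "enn2ereal (\<integral>\<^sup>+x. f (x, u x) (p x) \<partial>lebesgue_on \<Omega>) \<le> ereal (graph_pairing \<Omega> u p \<phi>) + ereal e"
proof -
  let ?M = "lebesgue_on \<Omega>"
  have \<Omega>m: "\<Omega> \<in> lmeasurable" using \<Omega> by (simp add: lmeasurable_open)
  then have \<Omega>s: "\<Omega> \<in> sets lebesgue" by (rule fmeasurableD)
  interpret finite_measure ?M using \<Omega>m by (rule finite_measure_lebesgue_on)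
  define F where "F = (\<lambda>x. f (x, u x) (p x))"
  have Fm: "F \<in> borel_measurable ?M"
    unfolding F_def by (rule borel_measurable_lsc_integrand[OF lsc \<Omega>s u p])
  \<comment> \<open>\<open>F\<close> is finite almost everywhere; at its infinite values
    \<open>F'\<close> takes the default 0 of \<open>enn2real\<close>.\<close>
  define F' where "F' = (\<lambda>x. enn2real (F x))"
  have F'm: "F' \<in> borel_measurable ?M" unfolding F'_def using Fm by measurable
  have nn: "(\<integral>\<^sup>+x. ennreal (F' x) \<partial>?M) = (\<integral>\<^sup>+x. F x \<partial>?M)"
  proof (rule nn_integral_cong_AE)
    have "AE x in ?M. F x \<noteq> \<infinity>"
      using fin Fm by (intro nn_integral_PInf_AE) (auto simp: F_def)
    then show "AE x in ?M. ennreal (F' x) = F x"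
      by eventually_elim (simp add: F'_def less_top)
  qed
  have F'i: "integrable ?M F'"
    using F'm nn fin by (intro integrableI_nonneg) (auto simp: F'_def F_def)
  have I: "enn2ereal (\<integral>\<^sup>+x. F x \<partial>?M) = ereal (LINT x|?M. F' x)"
  proof -
    have "(\<integral>\<^sup>+x. F x \<partial>?M) = ennreal (LINT x|?M. F' x)"
      unfolding nn[symmetric] using F'i by (intro nn_integral_eq_integral) (auto simp: F'_def)
    then show ?thesis by (simp add: enn2ereal_ennreal F'_def)
  qed
  \<comment> \<open>Bundling \<open>u\<close>, \<open>p\<close> and \<open>F'\<close> makes one
    Lusin set serve all three.\<close>
  have hm: "(\<lambda>x. (u x, p x, F' x)) \<in> borel_measurable ?M"
    by (intro borel_measurable_Pair u p F'm)
  have "e / 2 > 0" using \<open>e > 0\<close> by simp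
  then obtain C where C: "compact C" "C \<subseteq> \<Omega>" "continuous_on C (\<lambda>x. (u x, p x, F' x))"
    and Ci: "integrable ?M (\<lambda>x. indicator C x * F' x)"
    and CI: "(LINT x|?M. F' x) - e / 2 < (LINT x|?M. indicator C x * F' x)"
    by (rule lusin_integral[OF \<Omega>s \<Omega>(2) hm F'i])
  have "continuous_on C (\<lambda>x. fst (u x, p x, F' x))" "continuous_on C (\<lambda>x. fst (snd (u x, p x, F' x)))"
      "continuous_on C (\<lambda>x. snd (snd (u x, p x, F' x)))"
    by (intro continuous_intros C(3))+
  then have cont: "continuous_on C u" "continuous_on C p" "continuous_on C F'" by simp_all
  show thesis
  \<comment> \<open>\<open>infdist x {}\<close> is 0 by default, so the cutoffs need a nonempty
    \<open>C\<close>. For empty \<open>C\<close> the integral of \<open>F'\<close> is below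
    \<open>e / 2\<close> and the zero field suffices.\<close>
  proof (cases "C = {}")
    case True
    have "(\<lambda>t. 0) \<in> C0_on (\<Omega> \<times> \<Gamma>)"
      by (intro Cc_on_imp_C0_on Cc_onI[where T = "{}"]) auto
    then have "(\<lambda>t. 0) \<in> BB_admissible (\<Omega> \<times> \<Gamma>) f"
      by (simp add: BB_admissible_def conj_snd_le_iff zero_in_affine_minorants flip: zero_prod_def)
    moreover have "enn2ereal (\<integral>\<^sup>+x. F x \<partial>?M) \<le> ereal (graph_pairing \<Omega> u p (\<lambda>t. 0)) + ereal e"
      using CI True \<open>e > 0\<close> by (simp add: I graph_pairing_def)
    ultimately show thesis using that by (simp add: F_def)
  next
    case False
    define c where "c = measure ?M (space ?M)"
    \<comment> \<open>\<open>\<kappa>\<close> costs at most \<open>e / 2\<close> over all of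
      \<open>\<Omega>\<close>; \<open>c + 1\<close> avoids division by 0.\<close>
    define \<kappa> where "\<kappa> = e / (2 * (c + 1))"
    have c0: "c \<ge> 0" by (simp add: c_def)
    then have \<kappa>: "\<kappa> > 0" "\<kappa> * c \<le> e / 2"
      using \<open>e > 0\<close> by (auto simp: \<kappa>_def field_simps)
    have CM: "C \<in> sets ?M"
      using C(2) \<Omega>s fmeasurableD[OF lmeasurable_compact[OF C(1)]] by (simp add: sets_restrict_space_iff)
    have Ci': "integrable ?M (\<lambda>x. indicator C x * (F' x - \<kappa>))"
    proof -
      have "integrable ?M (\<lambda>x. indicator C x * F' x - \<kappa> * indicator C x)"
        using Ci CM by (intro Bochner_Integration.integrable_diff integrable_mult_right
          integrable_real_indicator) (auto simp: top.not_eq_extremum[symmetric])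
      then show ?thesis by (simp add: algebra_simps)
    qed
    have "(LINT x|?M. F' x) - e < (LINT x|?M. indicator C x * F' x) - \<kappa> * c"
      using CI \<kappa> by simp
    also have "\<dots> = (LINT x|?M. indicator C x * F' x - \<kappa>)"
      using Ci by (simp add: c_def)
    also have "\<dots> \<le> (LINT x|?M. indicator C x * (F' x - \<kappa>))"
      using Ci Ci' \<kappa> by (intro integral_mono) (auto simp: indicator_def)
    finally have r: "(LINT x|?M. F' x) - e < (LINT x|?M. indicator C x * (F' x - \<kappa>))" .
    \<comment> \<open>Where \<open>F\<close> is finite, subtracting \<open>\<kappa>\<close> gives
      strictness; where it is infinite, \<open>F' x - \<kappa>\<close> is negative.\<close>
    have "F' x - \<kappa> < 0 \<or> ennreal (F' x - \<kappa>) < f (x, u x) (p x)" for x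
    proof (cases "F x")
      case (real y)
      then have "F' x = y" by (simp add: F'_def)
      moreover have "ennreal (y - \<kappa>) < ennreal y" if "\<not> y - \<kappa> < 0"
        using that \<kappa>(1) by (intro ennreal_lessI) auto
      ultimately show ?thesis using real by (auto simp: F_def)
    next
      case top
      then show ?thesis using \<kappa> by (simp add: F'_def)
    qed
    moreover have "continuous_on C (\<lambda>x. F' x - \<kappa>)" by (intro continuous_intros cont)
    ultimately obtain \<phi> where \<phi>: "\<phi> \<in> BB_admissible (\<Omega> \<times> \<Gamma>) f" "(LINT x|?M. F' x) - e < graph_pairing \<Omega> u p \<phi>"
      using admissible_near_optimal_on_compact[OF \<Omega> \<Gamma> lsc cvx bdd u p E C(1,2) False cont(1,2) _ _ Ci' r] by blast
    have "enn2ereal (\<integral>\<^sup>+x. F x \<partial>?M) \<le> ereal (graph_pairing \<Omega> u p \<phi>) + ereal e"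
      using \<phi>(2) by (simp add: I)
    then show thesis using that[OF \<phi>(1)] by (simp add: F_def)
  qed
qed

theorem corollary10:
  fixes \<Omega> :: "'d::euclidean_space set"
    and \<Gamma> :: "'s::euclidean_space set"
    and f :: "'d \<times> 's \<Rightarrow> 'm::euclidean_space \<Rightarrow> ennreal"
    and u :: "'d \<Rightarrow> 's"
    and p :: "'d \<Rightarrow> 'm"
    and E :: "('d \<times> 's) set \<Rightarrow> 'm"
    and \<mu> :: "('d \<times> 's) set \<Rightarrow> real"
  assumes "open \<Omega>" and "bounded \<Omega>"
    and "compact \<Gamma>"
    and "lsc_on ((\<Omega> \<times> \<Gamma>) \<times> UNIV) (\<lambda>(t, q). f t q)"
    and "\<forall>t\<in>\<Omega> \<times> \<Gamma>. ennreal_convex (f t)"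
    and "locally_bounded_on (\<Omega> \<times> \<Gamma>) (\<lambda>t. f t 0)"
    and "u \<in> \<Omega> \<rightarrow> \<Gamma>"
    and "u \<in> borel_measurable (lebesgue_on \<Omega>)"
    and "p \<in> borel_measurable (lebesgue_on \<Omega>)"
    and "F_tilde \<Omega> f u p < \<infinity>"
    and "radon_vector_measure (\<Omega> \<times> \<Gamma>) (\<lambda>A. (E A, \<mu> A))"
    and "is_graph_delta \<Omega> \<Gamma> u \<mu>"
    and "is_graph_density \<Omega> \<Gamma> u p E"
  shows "BB_functional (\<Omega> \<times> \<Gamma>) f (\<lambda>A. (E A, \<mu> A))
           = enn2ereal (\<integral>\<^sup>+x. f (x, u x) (p x) \<partial>lebesgue_on \<Omega>)
       \<and> enn2ereal (\<integral>\<^sup>+x. f (x, u x) (p x) \<partial>lebesgue_on \<Omega>) = enn2ereal (F_tilde \<Omega> f u p)"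
proof (intro conjI antisym)
  have \<Omega>: "\<Omega> \<in> lmeasurable" using assms(1,2) by (simp add: lmeasurable_open)
  let ?I = "enn2ereal (\<integral>\<^sup>+x. f (x, u x) (p x) \<partial>lebesgue_on \<Omega>)"
  have BB: "BB_functional (\<Omega> \<times> \<Gamma>) f (\<lambda>A. (E A, \<mu> A))
      = (SUP \<phi>\<in>BB_admissible (\<Omega> \<times> \<Gamma>) f. ereal (graph_pairing \<Omega> u p \<phi>))"
    by (rule BB_functional_graph[OF \<Omega> assms(8,7,12,13)])
  show "BB_functional (\<Omega> \<times> \<Gamma>) f (\<lambda>A. (E A, \<mu> A)) \<le> ?I"
    unfolding BB by (intro SUP_least graph_pairing_le[OF \<Omega> assms(8,7,13)])
  show "?I \<le> BB_functional (\<Omega> \<times> \<Gamma>) f (\<lambda>A. (E A, \<mu> A))"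
    unfolding BB
  proof (rule ereal_le_epsilon2)
    fix e :: real assume "e > 0"
    have fin: "(\<integral>\<^sup>+x. f (x, u x) (p x) \<partial>lebesgue_on \<Omega>) < \<infinity>"
      using assms(10) by (simp add: F_tilde_def)
    obtain \<phi> where \<phi>: "\<phi> \<in> BB_admissible (\<Omega> \<times> \<Gamma>) f" "?I \<le> ereal (graph_pairing \<Omega> u p \<phi>) + ereal e"
      by (rule admissible_near_optimal[OF assms(1-6,8,7,9) fin assms(13) \<open>e > 0\<close>])
    note \<phi>(2)
    also have "ereal (graph_pairing \<Omega> u p \<phi>) + ereal e
        \<le> (SUP \<phi>\<in>BB_admissible (\<Omega> \<times> \<Gamma>) f. ereal (graph_pairing \<Omega> u p \<phi>)) + ereal e"
      by (intro add_right_mono SUP_upper \<phi>(1))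
    finally show "?I \<le> (SUP \<phi>\<in>BB_admissible (\<Omega> \<times> \<Gamma>) f. ereal (graph_pairing \<Omega> u p \<phi>)) + ereal e" .
  qed
qed (simp_all add: F_tilde_def)

end
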